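(* Let $\mathbb{F}$ be an algebraically closed field. Every $(n,m,k,\epsilon)$ linear seeded rank extractor for subspaces is also an $(n,m,k,\epsilon)$ linear seeded rank extractor for varieties.
   Context: Let $n\geq m$. A tuple $(\varphi_i)_{i\in[\ell]}$ of polynomial maps $\mathbb{F}^n\to\mathbb{F}^m$ is an $(n,m,k,\epsilon)$ seeded rank extractor for varieties (resp. subspaces) if for every affine variety (Zariski-closed subset) (resp. linear subspace) $V\subseteq\mathbb{F}^n$ of dimension at least $k$, all but at most an $\epsilon$-fraction of the indices $i$ satisfy $\dim\overline{\varphi_i(V)}=m$, where $\overline{\cdot}$ denotes Zariski closure. It is linear if each $\varphi_i$ is defined by linear polynomials. *)

theory Defs
  imports
    "HOL-Analysis.Analysis"
    "HOL-Computational_Algebra.Polynomial"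
    "HOL-Library.Poly_Mapping"
begin

text \<open>
  Polynomials in the variables \<open>X\<^sub>j\<close>, \<open>j :: 'n\<close>: finitely supported maps from exponent
  vectors to coefficients.
\<close>

type_synonym ('n, 'a) mvpoly = "('n \<Rightarrow>\<^sub>0 nat) \<Rightarrow>\<^sub>0 'a"

definition mvpoly_eval :: "('n::finite, 'a::comm_ring_1) mvpoly \<Rightarrow> 'a ^ 'n \<Rightarrow> 'a" where
  "mvpoly_eval p x =
     (\<Sum>e\<in>Poly_Mapping.keys p. Poly_Mapping.lookup p e * (\<Prod>j\<in>UNIV. (x $ j) ^ Poly_Mapping.lookup e j))"

definition linear_mvpoly :: "('n::finite, 'a::comm_ring_1) mvpoly \<Rightarrow> bool" where
  \<comment> \<open>total degree at most 1; a constant term is allowed\<close>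
  "linear_mvpoly p \<longleftrightarrow> (\<forall>e\<in>Poly_Mapping.keys p. (\<Sum>j\<in>UNIV. Poly_Mapping.lookup e j) \<le> 1)"

definition polynomial_map :: "('a::comm_ring_1 ^ 'n \<Rightarrow> 'a ^ 'm) \<Rightarrow> bool" where
  "polynomial_map f \<longleftrightarrow>
     (\<exists>P :: 'm \<Rightarrow> ('n, 'a) mvpoly. \<forall>x j. f x $ j = mvpoly_eval (P j) x)"

definition linear_polynomial_map :: "('a::comm_ring_1 ^ 'n \<Rightarrow> 'a ^ 'm) \<Rightarrow> bool" where
  "linear_polynomial_map f \<longleftrightarrow>
     (\<exists>P :: 'm \<Rightarrow> ('n, 'a) mvpoly.
        (\<forall>j. linear_mvpoly (P j)) \<and> (\<forall>x j. f x $ j = mvpoly_eval (P j) x))"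

definition zariski_closed :: "('a::field ^ 'n) set \<Rightarrow> bool" where
  "zariski_closed V \<longleftrightarrow>
     (\<exists>S :: ('n, 'a) mvpoly set. V = {x. \<forall>p\<in>S. mvpoly_eval p x = 0})"

definition zariski_closure :: "('a::field ^ 'n) set \<Rightarrow> ('a ^ 'n) set" where
  "zariski_closure A = \<Inter>{V. zariski_closed V \<and> A \<subseteq> V}"

definition zariski_irreducible :: "('a::field ^ 'n) set \<Rightarrow> bool" where
  "zariski_irreducible V \<longleftrightarrow>
     zariski_closed V \<and> V \<noteq> {} \<and>
     (\<forall>A B. zariski_closed A \<and> zariski_closed B \<and> V = A \<union> B \<longrightarrow> V = A \<or> V = B)"

text \<open>
  Dimension of a Zariski-closed set: the supremum of the lengths \<open>d\<close> of chains
  \<open>C\<^sub>0 \<subset> \<dots> \<subset> C\<^sub>d\<close> of irreducible closed subsets. It is taken in \<open>ereal\<close>, so that the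
  empty set has dimension \<open>-\<infinity>\<close>.
\<close>

definition zariski_dim :: "('a::field ^ 'n) set \<Rightarrow> ereal" where
  "zariski_dim V =
     Sup {ereal (real d) | d. \<exists>C :: nat \<Rightarrow> ('a ^ 'n) set.
            (\<forall>i\<le>d. zariski_irreducible (C i) \<and> C i \<subseteq> V) \<and> (\<forall>i<d. C i \<subset> C (Suc i))}"

text \<open>
  The parameters \<open>n\<close> and \<open>m\<close> are \<open>CARD('n)\<close> and \<open>CARD('m)\<close>; the index set of the tuple
  is \<open>{1..l}\<close>.
\<close>

definition rank_failures ::
  "nat \<Rightarrow> (nat \<Rightarrow> 'a::field ^ 'n \<Rightarrow> 'a ^ 'm) \<Rightarrow> ('a ^ 'n) set \<Rightarrow> nat set" where
  "rank_failures l \<phi> V =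
     {i\<in>{1..l}. zariski_dim (zariski_closure (\<phi> i ` V)) \<noteq> ereal (real CARD('m))}"

definition seeded_rank_extractor_varieties ::
  "nat \<Rightarrow> real \<Rightarrow> nat \<Rightarrow> (nat \<Rightarrow> 'a::field ^ 'n \<Rightarrow> 'a ^ 'm) \<Rightarrow> bool" where
  "seeded_rank_extractor_varieties k \<epsilon> l \<phi> \<longleftrightarrow>
     CARD('m) \<le> CARD('n) \<and> (\<forall>i\<in>{1..l}. polynomial_map (\<phi> i)) \<and>
     (\<forall>V. zariski_closed V \<and> ereal (real k) \<le> zariski_dim V \<longrightarrow>
        real (card (rank_failures l \<phi> V)) \<le> \<epsilon> * real l)"

definition seeded_rank_extractor_subspaces ::
  "nat \<Rightarrow> real \<Rightarrow> nat \<Rightarrow> (nat \<Rightarrow> 'a::field ^ 'n \<Rightarrow> 'a ^ 'm) \<Rightarrow> bool" where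
  "seeded_rank_extractor_subspaces k \<epsilon> l \<phi> \<longleftrightarrow>
     CARD('m) \<le> CARD('n) \<and> (\<forall>i\<in>{1..l}. polynomial_map (\<phi> i)) \<and>
     (\<forall>V. vec.subspace V \<and> k \<le> vec.dim V \<longrightarrow>
        real (card (rank_failures l \<phi> V)) \<le> \<epsilon> * real l)"

definition linear_seeded_rank_extractor_varieties ::
  "nat \<Rightarrow> real \<Rightarrow> nat \<Rightarrow> (nat \<Rightarrow> 'a::field ^ 'n \<Rightarrow> 'a ^ 'm) \<Rightarrow> bool" where
  "linear_seeded_rank_extractor_varieties k \<epsilon> l \<phi> \<longleftrightarrow>
     seeded_rank_extractor_varieties k \<epsilon> l \<phi> \<and> (\<forall>i\<in>{1..l}. linear_polynomial_map (\<phi> i))"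

definition linear_seeded_rank_extractor_subspaces ::
  "nat \<Rightarrow> real \<Rightarrow> nat \<Rightarrow> (nat \<Rightarrow> 'a::field ^ 'n \<Rightarrow> 'a ^ 'm) \<Rightarrow> bool" where
  "linear_seeded_rank_extractor_subspaces k \<epsilon> l \<phi> \<longleftrightarrow>
     seeded_rank_extractor_subspaces k \<epsilon> l \<phi> \<and> (\<forall>i\<in>{1..l}. linear_polynomial_map (\<phi> i))"

end

theory Submission
  imports Defs
begin

text \<open>
  Let \<open>V\<close> be irreducible, the top of a chain of \<open>k + 1\<close> irreducible closed sets. If \<open>\<phi>\<^sub>i(V)\<close> is not dense,
  a polynomial of minimal degree vanishing on \<open>\<phi>\<^sub>i(V)\<close> has a gradient \<open>\<nu>\<close> that is nonzero at some point of
  \<open>\<phi>\<^sub>i(V)\<close>, because the field is perfect. At a generic \<open>a \<in> V\<close> this holds for all such \<open>i\<close> at once, and the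
  linear part of \<open>\<phi>\<^sub>i\<close> maps the tangent space \<open>W\<close> of \<open>V\<close> at \<open>a\<close> into the hyperplane orthogonal to \<open>\<nu>\<close>. So
  every index that fails for \<open>V\<close> fails for the subspace \<open>W\<close>, and it remains to see that \<open>dim W \<ge> k\<close>.

  The gradients at \<open>a\<close> of the functions vanishing on \<open>V\<close> span, together with the coordinate vectors
  \<open>e\<^sub>z\<close> for some \<open>Z\<close> with \<open>|Z| \<le> dim W\<close>, the whole space. Replacing derivatives by difference quotients
  turns the Jacobian matrix into a matrix of polynomials in two points, and its determinant \<open>u\<close> lies in
  \<open>R \<otimes>\<^sub>A R\<close>, where \<open>R\<close> is the ring of polynomial functions on \<open>V\<close> and \<open>A\<close> its subring generated by the
  coordinates in \<open>Z\<close>. By Cramer's rule \<open>u\<close> annihilates all \<open>g \<otimes> 1 - 1 \<otimes> g\<close>, while its restriction to the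
  diagonal is nonzero; this makes \<open>R\<close> an \<open>A\<close>-module of finite rank. Comparing growth rates, \<open>R\<close> contains
  at most \<open>|Z|\<close> algebraically independent functions, whereas a chain of length \<open>k\<close> provides \<open>k\<close> of them.
\<close>

section \<open>Algebras of functions\<close>

abbreviation vanishes_on :: "('b \<Rightarrow> 'a::zero) \<Rightarrow> 'b set \<Rightarrow> bool" where
  "vanishes_on f V \<equiv> \<forall>x\<in>V. f x = 0"

inductive_set subalg :: "('b \<Rightarrow> 'a::comm_ring_1) set \<Rightarrow> ('b \<Rightarrow> 'a) set" for X where
  const [intro]: "(\<lambda>_. c) \<in> subalg X"
| gen: "f \<in> X \<Longrightarrow> f \<in> subalg X"
| add [intro]: "f \<in> subalg X \<Longrightarrow> g \<in> subalg X \<Longrightarrow> (\<lambda>x. f x + g x) \<in> subalg X"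
| mult [intro]: "f \<in> subalg X \<Longrightarrow> g \<in> subalg X \<Longrightarrow> (\<lambda>x. f x * g x) \<in> subalg X"

lemma subalg_minus [intro]: "f \<in> subalg X \<Longrightarrow> (\<lambda>x. - f x) \<in> subalg X"
  using subalg.mult[OF subalg.const[of "-1"]] by simp

lemma subalg_diff [intro]:
  "f \<in> subalg X \<Longrightarrow> g \<in> subalg X \<Longrightarrow> (\<lambda>x. f x - g x) \<in> subalg X"
  using subalg.add[OF _ subalg_minus, of f X g] by simp

lemma subalg_power [intro]: "f \<in> subalg X \<Longrightarrow> (\<lambda>x. f x ^ i) \<in> subalg X"
  by (induction i) auto

lemma subalg_sum [intro]:
  "(\<And>i. i \<in> A \<Longrightarrow> f i \<in> subalg X) \<Longrightarrow> (\<lambda>x. \<Sum>i\<in>A. f i x) \<in> subalg X"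
  by (induction A rule: infinite_finite_induct) auto

lemma subalg_sum_list:
  "(\<And>p. p \<in> set L \<Longrightarrow> f p \<in> subalg X) \<Longrightarrow> (\<lambda>x. \<Sum>p\<leftarrow>L. f p x) \<in> subalg X"
  by (induction L) auto

lemma subalg_prod [intro]:
  "(\<And>i. i \<in> A \<Longrightarrow> f i \<in> subalg X) \<Longrightarrow> (\<lambda>x. \<Prod>i\<in>A. f i x) \<in> subalg X"
  by (induction A rule: infinite_finite_induct) auto

lemma subalg_det:
  fixes M :: "'b \<Rightarrow> 'a::comm_ring_1 ^ 'n ^ 'n"
  assumes "\<And>i j. (\<lambda>x. M x $ i $ j) \<in> subalg X"
  shows "(\<lambda>x. det (M x)) \<in> subalg X"
  unfolding det_def by (intro subalg_sum subalg.mult subalg.const subalg_prod assms)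

lemma subalg_least:
  assumes "X \<subseteq> subalg Y"
  shows "subalg X \<subseteq> subalg Y"
proof
  fix f
  assume "f \<in> subalg X"
  then show "f \<in> subalg Y"
    by (induction rule: subalg.induct) (use assms in auto)
qed

lemma subalg_comp:
  assumes "f \<in> subalg X" "\<And>g. g \<in> X \<Longrightarrow> (\<lambda>x. g (\<rho> x)) \<in> subalg Y"
  shows "(\<lambda>x. f (\<rho> x)) \<in> subalg Y"
  using assms by (induction rule: subalg.induct) auto

definition integral_on :: "'b set \<Rightarrow> ('b \<Rightarrow> 'a::comm_ring_1) set \<Rightarrow> bool" where
  "integral_on V R \<longleftrightarrow> V \<noteq> {} \<and>
     (\<forall>f\<in>R. \<forall>g\<in>R. vanishes_on (\<lambda>x. f x * g x) V \<longrightarrow> vanishes_on f V \<or> vanishes_on g V)"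

lemma integral_onI:
  "V \<noteq> {} \<Longrightarrow> (\<And>f g. f \<in> R \<Longrightarrow> g \<in> R \<Longrightarrow> vanishes_on (\<lambda>x. f x * g x) V \<Longrightarrow>
    vanishes_on f V \<or> vanishes_on g V) \<Longrightarrow> integral_on V R"
  unfolding integral_on_def by blast

lemma integral_on_subset: "integral_on V R \<Longrightarrow> Q \<subseteq> R \<Longrightarrow> integral_on V Q"
  unfolding integral_on_def by blast

lemma integral_onD:
  assumes "integral_on V R" "f \<in> R" "g \<in> R" "\<not> vanishes_on f V" "\<And>x. x \<in> V \<Longrightarrow> f x * g x = 0"
    "x \<in> V"
  shows "g x = 0"
  using assms unfolding integral_on_def by blast

lemma integral_on_mult:
  assumes "integral_on V R" "f \<in> R" "g \<in> R" "\<not> vanishes_on f V" "\<not> vanishes_on g V"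
  shows "\<not> vanishes_on (\<lambda>x. f x * g x) V"
  using assms unfolding integral_on_def by blast

lemma integral_on_prod:
  assumes "integral_on V (subalg Y)" "\<And>i. i \<in> I \<Longrightarrow> f i \<in> subalg Y"
    "\<And>i. i \<in> I \<Longrightarrow> \<not> vanishes_on (f i) V"
  shows "\<not> vanishes_on (\<lambda>x. \<Prod>i\<in>I. f i x) V"
  using assms(2,3)
proof (induction I rule: infinite_finite_induct)
  case (insert i I)
  then have "\<not> vanishes_on (\<lambda>x. f i x * (\<Prod>i\<in>I. f i x)) V"
    by (intro integral_on_mult[OF assms(1)] subalg_prod) auto
  then show ?case
    using insert.hyps by simp
qed (use assms(1) in \<open>auto simp: integral_on_def\<close>)

lemma integral_on_power:
  assumes "integral_on V (subalg Y)" "f \<in> subalg Y" "\<not> vanishes_on f V"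
  shows "\<not> vanishes_on (\<lambda>x. f x ^ n) V"
  using integral_on_prod[of V Y "{..<n}" "\<lambda>_. f"] assms by simp

section \<open>Monomials and algebraic independence\<close>

definition monomial :: "'i set \<Rightarrow> ('i \<Rightarrow> 'b \<Rightarrow> 'a::comm_ring_1) \<Rightarrow> ('i \<Rightarrow> nat) \<Rightarrow> 'b \<Rightarrow> 'a" where
  "monomial I f e x = (\<Prod>i\<in>I. f i x ^ e i)"

definition exponents :: "'i set \<Rightarrow> nat \<Rightarrow> ('i \<Rightarrow> nat) set" where
  "exponents I d = {e. (\<forall>i. i \<notin> I \<longrightarrow> e i = 0) \<and> sum e I \<le> d}"

lemma monomial_0 [simp]: "monomial I f (\<lambda>_. 0) x = 1"
  by (simp add: monomial_def)

lemma monomial_add: "monomial I f (\<lambda>i. e i + e' i) x = monomial I f e x * monomial I f e' x"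
  by (simp add: monomial_def power_add prod.distrib)

lemma monomial_upd:
  assumes "finite I" "i \<in> I"
  shows "monomial I f (e(i := k)) x = f i x ^ k * (\<Prod>j\<in>I - {i}. f j x ^ e j)"
  using assms by (simp add: monomial_def prod.remove[of I i])

lemma monomial_Suc:
  assumes "finite I" "i \<in> I"
  shows "monomial I f (e(i := Suc (e i))) x = f i x * monomial I f e x"
  using monomial_upd[OF assms, of f e "Suc (e i)" x] monomial_upd[OF assms, of f e "e i" x]
  by (simp add: mult.assoc)

lemma monomial_insert:
  assumes "finite I" "i \<notin> I" "e i = 0"
  shows "monomial (insert i I) f e x = monomial I f e x"
  using assms by (simp add: monomial_def)

lemma monomial_subalg: "(\<And>i. i \<in> I \<Longrightarrow> f i \<in> subalg X) \<Longrightarrow> monomial I f e \<in> subalg X"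
  unfolding monomial_def[abs_def] by (intro subalg_prod subalg_power)

lemma exponents_0 [simp]: "finite I \<Longrightarrow> exponents I 0 = {\<lambda>_. 0}"
  by (auto simp: exponents_def fun_eq_iff)

lemma exponents_empty [simp]: "exponents {} d = {\<lambda>_. 0}"
  by (auto simp: exponents_def fun_eq_iff)

lemma exponents_mono: "d \<le> d' \<Longrightarrow> exponents I d \<subseteq> exponents I d'"
  by (auto simp: exponents_def)

lemma sum_fun_upd:
  assumes "finite I" "i \<in> I"
  shows "sum (e(i := k)) I + e i = sum e I + (k :: nat)"
  using assms by (simp add: sum.remove[of I i])

lemma upd_Suc_in_exponents_iff:
  assumes "finite I" "i \<in> I"
  shows "e(i := Suc (e i)) \<in> exponents I (Suc d) \<longleftrightarrow> e \<in> exponents I d"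
  using sum_fun_upd[OF assms, of e "Suc (e i)"] assms(2) by (auto simp: exponents_def)

lemma upd_pred_in_exponents:
  assumes "finite I" "i \<in> I" "e \<in> exponents I (Suc d)" "e i \<noteq> 0"
  shows "e(i := e i - 1) \<in> exponents I d"
  using upd_Suc_in_exponents_iff[OF assms(1,2), of "e(i := e i - 1)" d] assms(3,4) by simp

lemma exponents_insert_Suc:
  assumes "finite I" "i \<notin> I"
  shows "exponents (insert i I) (Suc d) =
    exponents I (Suc d) \<union> (\<lambda>e. e(i := Suc (e i))) ` exponents (insert i I) d"
    (is "?lhs = ?rhs")
proof (intro equalityI subsetI)
  fix e
  assume e_in: "e \<in> ?lhs"
  show "e \<in> ?rhs"
  proof (cases "e i = 0")
    case True
    then have "e \<in> exponents I (Suc d)"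
      using e_in assms by (auto simp: exponents_def) metis
    then show ?thesis
      by blast
  next
    case False
    then have "e(i := e i - 1) \<in> exponents (insert i I) d"
      using e_in assms(1) by (intro upd_pred_in_exponents) auto
    then show ?thesis
      using False by (intro UnI2 image_eqI[of _ _ "e(i := e i - 1)"]) auto
  qed
next
  fix e
  assume "e \<in> ?rhs"
  then show "e \<in> ?lhs"
  proof
    assume e_in: "e \<in> exponents I (Suc d)"
    then have "e i = 0"
      using assms(2) by (auto simp: exponents_def)
    then show ?thesis
      using e_in assms by (auto simp: exponents_def)
  qed (use assms(1) in \<open>auto simp: upd_Suc_in_exponents_iff\<close>)
qed

lemma exponents_Int_Suc_image:
  assumes "i \<notin> I"
  shows "exponents I d \<inter> (\<lambda>e. e(i := Suc (e i))) ` E = {}"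
proof -
  have "e i = 0" if "e \<in> exponents I d" for e
    using assms that by (simp add: exponents_def)
  then show ?thesis
    by fastforce
qed

lemma inj_fun_upd_Suc: "inj (\<lambda>e. e(i := Suc (e i)))"
proof (rule injI)
  fix e e' :: "'a \<Rightarrow> nat"
  assume eq: "e(i := Suc (e i)) = e'(i := Suc (e' i))"
  have "e j = e' j" for j
    using fun_cong[OF eq, of j] by (cases "j = i") auto
  then show "e = e'"
    by blast
qed

lemma finite_card_exponents:
  assumes "finite I"
  shows "finite (exponents I d) \<and> card (exponents I d) = (card I + d) choose card I"
  using assms
proof (induction I arbitrary: d rule: finite_induct)
  case (insert i I)
  show ?case
  proof (induction d)
    case 0
    then show ?case
      using insert.hyps by simp
  next
    case (Suc d)
    have "card (exponents (insert i I) (Suc d)) =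
        card (exponents I (Suc d)) + card (exponents (insert i I) d)"
      unfolding exponents_insert_Suc[OF insert.hyps]
      using insert.IH[of "Suc d"] Suc.IH exponents_Int_Suc_image[OF insert.hyps(2)]
      by (simp add: card_Un_disjoint card_image inj_on_subset[OF inj_fun_upd_Suc])
    then show ?case
      using insert.IH[of "Suc d"] Suc.IH insert.hyps
      by (simp add: exponents_insert_Suc)
  qed
qed simp

lemma finite_exponents: "finite I \<Longrightarrow> finite (exponents I d)"
  using finite_card_exponents by blast

lemma card_exponents: "finite I \<Longrightarrow> card (exponents I d) = (card I + d) choose card I"
  using finite_card_exponents by blast

lemma sum_exponents_insert:
  fixes F :: "('i \<Rightarrow> nat) \<Rightarrow> 'a::comm_monoid_add"
  assumes "finite I" "i \<notin> I"
  shows "(\<Sum>e\<in>exponents (insert i I) (Suc d). F e) =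
    (\<Sum>e\<in>exponents I (Suc d). F e) + (\<Sum>e\<in>exponents (insert i I) d. F (e(i := Suc (e i))))"
  unfolding exponents_insert_Suc[OF assms] using assms
  by (subst sum.union_disjoint)
    (simp_all add: finite_exponents exponents_Int_Suc_image sum.reindex
      inj_on_subset[OF inj_fun_upd_Suc])

definition degree_le ::
    "'i set \<Rightarrow> ('i \<Rightarrow> 'b \<Rightarrow> 'a::comm_ring_1) \<Rightarrow> nat \<Rightarrow> ('b \<Rightarrow> 'a) set" where
  "degree_le I f d = {g. \<exists>c. g = (\<lambda>x. \<Sum>e\<in>exponents I d. c e * monomial I f e x)}"

lemma degree_leI: "g = (\<lambda>x. \<Sum>e\<in>exponents I d. c e * monomial I f e x) \<Longrightarrow> g \<in> degree_le I f d"
  by (auto simp: degree_le_def)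

lemma degree_leE:
  assumes "g \<in> degree_le I f d"
  obtains c where "g = (\<lambda>x. \<Sum>e\<in>exponents I d. c e * monomial I f e x)"
  using assms by (auto simp: degree_le_def)

lemma degree_le_mono:
  assumes "finite I" "g \<in> degree_le I f d" "d \<le> d'"
  shows "g \<in> degree_le I f d'"
proof -
  obtain c where c: "g = (\<lambda>x. \<Sum>e\<in>exponents I d. c e * monomial I f e x)"
    using assms(2) by (rule degree_leE)
  have "g = (\<lambda>x. \<Sum>e\<in>exponents I d'. (if e \<in> exponents I d then c e else 0) * monomial I f e x)"
    unfolding c using assms(1,3) exponents_mono[of d d' I]
    by (intro ext sum.mono_neutral_cong_left) (auto simp: finite_exponents)
  then show ?thesis
    by (rule degree_leI)
qed

lemma degree_le_add:
  assumes "g \<in> degree_le I f d" "h \<in> degree_le I f d"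
  shows "(\<lambda>x. g x + h x) \<in> degree_le I f d"
proof -
  obtain b c where "g = (\<lambda>x. \<Sum>e\<in>exponents I d. b e * monomial I f e x)"
    "h = (\<lambda>x. \<Sum>e\<in>exponents I d. c e * monomial I f e x)"
    using assms by (auto elim!: degree_leE)
  then have "(\<lambda>x. g x + h x) = (\<lambda>x. \<Sum>e\<in>exponents I d. (b e + c e) * monomial I f e x)"
    by (simp add: distrib_right sum.distrib)
  then show ?thesis
    by (rule degree_leI)
qed

lemma degree_le_scale:
  assumes "g \<in> degree_le I f d"
  shows "(\<lambda>x. k * g x) \<in> degree_le I f d"
proof -
  obtain c where "g = (\<lambda>x. \<Sum>e\<in>exponents I d. c e * monomial I f e x)"
    using assms by (rule degree_leE)
  then have "(\<lambda>x. k * g x) = (\<lambda>x. \<Sum>e\<in>exponents I d. (k * c e) * monomial I f e x)"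
    by (simp add: sum_distrib_left mult.assoc)
  then show ?thesis
    by (rule degree_leI)
qed

lemma degree_le_0: "(\<lambda>_. 0) \<in> degree_le I f d"
  by (rule degree_leI[of _ "\<lambda>_. 0"]) simp

lemma degree_le_sum:
  "(\<And>i. i \<in> A \<Longrightarrow> g i \<in> degree_le I f d) \<Longrightarrow> (\<lambda>x. \<Sum>i\<in>A. g i x) \<in> degree_le I f d"
  by (induction A rule: infinite_finite_induct) (auto intro: degree_le_add degree_le_0)

lemma monomial_degree_le:
  assumes "finite I" "e \<in> exponents I d"
  shows "monomial I f e \<in> degree_le I f d"
proof -
  have "monomial I f e = (\<lambda>x. \<Sum>e'\<in>exponents I d. (if e' = e then 1 else 0) * monomial I f e' x)"
    using assms by (simp add: finite_exponents if_distrib[of "\<lambda>c. c * _"] cong: if_cong)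
  then show ?thesis
    by (rule degree_leI)
qed

lemma degree_le_mult:
  assumes "finite I" "g \<in> degree_le I f d" "h \<in> degree_le I f d'"
  shows "(\<lambda>x. g x * h x) \<in> degree_le I f (d + d')"
proof -
  obtain b c where g: "g = (\<lambda>x. \<Sum>e\<in>exponents I d. b e * monomial I f e x)"
    and h: "h = (\<lambda>x. \<Sum>e\<in>exponents I d'. c e * monomial I f e x)"
    using assms(2,3) by (auto elim!: degree_leE)
  have "(\<lambda>x. g x * h x) = (\<lambda>x. \<Sum>e\<in>exponents I d. \<Sum>e'\<in>exponents I d'.
      b e * c e' * monomial I f (\<lambda>i. e i + e' i) x)"
    unfolding g h by (simp add: sum_product monomial_add mult_ac)
  moreover have "(\<lambda>i. e i + e' i) \<in> exponents I (d + d')"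
    if "e \<in> exponents I d" "e' \<in> exponents I d'" for e e'
    using that by (simp add: exponents_def sum.distrib)
  ultimately show ?thesis
    using assms(1) by (auto intro!: degree_le_sum degree_le_scale monomial_degree_le)
qed

lemma subalg_imp_degree_le:
  assumes "finite I" "g \<in> subalg (f ` I)"
  shows "\<exists>d. g \<in> degree_le I f d"
  using assms(2)
proof (induction rule: subalg.induct)
  case (const c)
  have "monomial I f (\<lambda>_. 0) \<in> degree_le I f 0"
    using assms(1) by (intro monomial_degree_le) auto
  then show ?case
    using degree_le_scale[of "\<lambda>_. 1" I f 0 c] by (auto simp: monomial_def[abs_def])
next
  case (gen g)
  then obtain i where i: "i \<in> I" "g = f i"
    by blast
  have "(\<lambda>_. 0)(i := 1) \<in> exponents I 1"
    using assms(1) i by (auto simp: exponents_def)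
  then have "monomial I f ((\<lambda>_. 0)(i := 1)) \<in> degree_le I f 1"
    by (rule monomial_degree_le[OF assms(1)])
  moreover have "monomial I f ((\<lambda>_. 0)(i := 1)) = g"
    using monomial_Suc[OF assms(1) i(1), of f "\<lambda>_. 0"] by (simp add: i fun_eq_iff)
  ultimately show ?case
    by auto
next
  case (add g h)
  then obtain d d' where "g \<in> degree_le I f d" "h \<in> degree_le I f d'"
    by blast
  then have "g \<in> degree_le I f (d + d')" "h \<in> degree_le I f (d + d')"
    using degree_le_mono[OF assms(1)] by (metis le_add1 le_add2)+
  then show ?case
    using degree_le_add by blast
next
  case (mult g h)
  then show ?case
    using degree_le_mult[OF assms(1)] by blast
qed

definition alg_indep :: "'b set \<Rightarrow> 'i set \<Rightarrow> ('i \<Rightarrow> 'b \<Rightarrow> 'a::comm_ring_1) \<Rightarrow> bool" where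
  "alg_indep V I f \<longleftrightarrow>
     (\<forall>d c. vanishes_on (\<lambda>x. \<Sum>e\<in>exponents I d. c e * monomial I f e x) V \<longrightarrow>
        vanishes_on c (exponents I d))"

lemma alg_indepD:
  assumes "alg_indep V I f" "\<And>x. x \<in> V \<Longrightarrow> (\<Sum>e\<in>exponents I d. c e * monomial I f e x) = 0"
    "e \<in> exponents I d"
  shows "c e = 0"
  using assms unfolding alg_indep_def by blast

lemma alg_indep_cong:
  assumes "\<And>i. i \<in> I \<Longrightarrow> f i = g i"
  shows "alg_indep V I f \<longleftrightarrow> alg_indep V I g"
  using assms by (simp add: alg_indep_def monomial_def)

lemma sum_monomials_insert:
  fixes f :: "'i \<Rightarrow> 'b \<Rightarrow> 'a::comm_ring_1"
  assumes "finite I" "i \<notin> I"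
  shows "(\<Sum>e\<in>exponents (insert i I) (Suc d). c e * monomial (insert i I) f e x) =
    (\<Sum>e\<in>exponents I (Suc d). c e * monomial I f e x) +
    f i x * (\<Sum>e\<in>exponents (insert i I) d. c (e(i := Suc (e i))) * monomial (insert i I) f e x)"
proof -
  have "(\<Sum>e\<in>exponents I (Suc d). c e * monomial (insert i I) f e x) =
      (\<Sum>e\<in>exponents I (Suc d). c e * monomial I f e x)"
    using assms by (intro sum.cong refl arg_cong2[of _ _ _ _ "(*)"] monomial_insert)
      (auto simp: exponents_def)
  then show ?thesis
    using assms(1)
    by (simp add: sum_exponents_insert[OF assms] monomial_Suc sum_distrib_left mult.left_commute)
qed

text \<open>On \<open>W\<close> only the terms free of \<open>f\<^sub>i\<close> survive, so their coefficients vanish and \<open>f\<^sub>i\<close> cancels.\<close>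

lemma alg_indep_insert:
  fixes f :: "'i \<Rightarrow> 'b \<Rightarrow> 'a::comm_ring_1"
  assumes I: "finite I" "i \<notin> I" and indep: "alg_indep W I f" and "W \<subseteq> V"
    and integral: "integral_on V (subalg Y)" and f: "\<And>j. j \<in> insert i I \<Longrightarrow> f j \<in> subalg Y"
    and new: "vanishes_on (f i) W" "\<not> vanishes_on (f i) V"
  shows "alg_indep V (insert i I) f"
  unfolding alg_indep_def
proof (intro allI impI)
  fix d and c :: "('i \<Rightarrow> nat) \<Rightarrow> 'a"
  assume "vanishes_on (\<lambda>x. \<Sum>e\<in>exponents (insert i I) d. c e * monomial (insert i I) f e x) V"
  then show "vanishes_on c (exponents (insert i I) d)"
  proof (induction d arbitrary: c)
    case 0
    then show ?case
      using I(1) integral by (auto simp: integral_on_def)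
  next
    case (Suc d)
    define h where "h x =
      (\<Sum>e\<in>exponents (insert i I) d. c (e(i := Suc (e i))) * monomial (insert i I) f e x)" for x
    have relation: "(\<Sum>e\<in>exponents I (Suc d). c e * monomial I f e x) + f i x * h x = 0"
      if "x \<in> V" for x
      using bspec[OF Suc.prems that] by (simp add: sum_monomials_insert[OF I] h_def)
    have free_terms: "c e = 0" if "e \<in> exponents I (Suc d)" for e
    proof (rule alg_indepD[OF indep _ that])
      show "(\<Sum>e\<in>exponents I (Suc d). c e * monomial I f e x) = 0" if "x \<in> W" for x
        using relation[of x] that new(1) \<open>W \<subseteq> V\<close> by auto
    qed
    have "h x = 0" if "x \<in> V" for x
    proof (rule integral_onD[OF integral _ _ new(2) _ that])
      show "h \<in> subalg Y"
        unfolding h_def using f by (intro subalg_sum subalg.mult subalg.const monomial_subalg)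
      show "f i x * h x = 0" if "x \<in> V" for x
        using relation[OF that] free_terms by simp
    qed (use f in simp)
    then have "vanishes_on (\<lambda>e. c (e(i := Suc (e i)))) (exponents (insert i I) d)"
      unfolding h_def by (intro Suc.IH) blast
    then show ?case
      using free_terms unfolding exponents_insert_Suc[OF I] by auto
  qed
qed

section \<open>Linear algebra over a domain of functions\<close>

definition nontrivial_solution ::
    "'b set \<Rightarrow> ('b \<Rightarrow> 'a::comm_ring_1) set \<Rightarrow> 'p set \<Rightarrow> 'q set \<Rightarrow> ('p \<Rightarrow> 'q \<Rightarrow> 'b \<Rightarrow> 'a) \<Rightarrow>
      ('p \<Rightarrow> 'b \<Rightarrow> 'a) \<Rightarrow> bool" where
  "nontrivial_solution V A P Q t c \<longleftrightarrow> (\<forall>p\<in>P. c p \<in> A) \<and> (\<exists>p\<in>P. \<not> vanishes_on (c p) V) \<and>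
     (\<forall>q\<in>Q. vanishes_on (\<lambda>x. \<Sum>p\<in>P. c p x * t p q x) V)"

lemma pivot_elimination:
  fixes t :: "'p \<Rightarrow> 'q \<Rightarrow> 'a::comm_ring_1"
  assumes "finite P" "p0 \<in> P"
  shows "(\<Sum>p\<in>P. (if p = p0 then - (\<Sum>p\<in>P - {p0}. c p * t p q) else c p * t p0 q) * t p r) =
    (\<Sum>p\<in>P - {p0}. c p * (t p0 q * t p r - t p q * t p0 r))"
proof -
  have "(\<Sum>p\<in>P. (if p = p0 then - (\<Sum>p\<in>P - {p0}. c p * t p q) else c p * t p0 q) * t p r) =
      - (\<Sum>p\<in>P - {p0}. c p * t p q) * t p0 r + (\<Sum>p\<in>P - {p0}. c p * t p0 q * t p r)"
    using assms by (simp add: sum.remove)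
  then show ?thesis
    by (simp add: sum_distrib_right right_diff_distrib sum_subtractf mult.assoc)
qed

lemma nontrivial_solution_insert:
  assumes "integral_on V (subalg X)" "finite P" "p0 \<in> P" "\<not> vanishes_on (t p0 q) V"
    and t: "\<And>p r. p \<in> P \<Longrightarrow> r \<in> insert q Q \<Longrightarrow> t p r \<in> subalg X"
    and reduced: "nontrivial_solution V (subalg X) (P - {p0}) Q
      (\<lambda>p r x. t p0 q x * t p r x - t p q x * t p0 r x) c"
  shows "\<exists>c'. nontrivial_solution V (subalg X) P (insert q Q) t c'"
proof -
  define c' where "c' p x =
    (if p = p0 then - (\<Sum>p\<in>P - {p0}. c p x * t p q x) else c p x * t p0 q x)" for p x
  have c: "c p \<in> subalg X" if "p \<in> P - {p0}" for p
    using reduced that by (simp add: nontrivial_solution_def)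
  have "c' p \<in> subalg X" if "p \<in> P" for p
    unfolding c'_def using c t assms(3) that
    by (cases "p = p0") (auto intro!: subalg_minus subalg_sum subalg.mult)
  moreover have "\<exists>p\<in>P. \<not> vanishes_on (c' p) V"
  proof -
    obtain p where p: "p \<in> P - {p0}" "\<not> vanishes_on (c p) V"
      using reduced unfolding nontrivial_solution_def by blast
    have "\<not> vanishes_on (\<lambda>x. c p x * t p0 q x) V"
      using p(2) assms(3,4) by (intro integral_on_mult[OF assms(1) c[OF p(1)] t]) auto
    then have "\<not> vanishes_on (c' p) V"
      using p(1) by (simp add: c'_def)
    then show ?thesis
      using p(1) by blast
  qed
  moreover have "vanishes_on (\<lambda>x. \<Sum>p\<in>P. c' p x * t p r x) V" if "r \<in> insert q Q" for r
  proof -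
    have "(\<Sum>p\<in>P. c' p x * t p r x) =
        (\<Sum>p\<in>P - {p0}. c p x * (t p0 q x * t p r x - t p q x * t p0 r x))" for x
      unfolding c'_def by (rule pivot_elimination[OF assms(2,3)])
    then show ?thesis
      using reduced that by (auto simp: nontrivial_solution_def mult.commute)
  qed
  ultimately show ?thesis
    unfolding nontrivial_solution_def by blast
qed

lemma ex_nontrivial_solution:
  assumes "integral_on V (subalg X)" "finite Q" "finite P" "card Q < card P"
    and "\<And>p q. p \<in> P \<Longrightarrow> q \<in> Q \<Longrightarrow> t p q \<in> subalg X"
  shows "\<exists>c. nontrivial_solution V (subalg X) P Q t c"
  using assms(2-)
proof (induction Q arbitrary: P t rule: finite_induct)
  case empty
  then show ?case
    using assms(1) by (intro exI[of _ "\<lambda>_ _. 1"])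
      (auto simp: nontrivial_solution_def integral_on_def card_gt_0_iff)
next
  case (insert q Q)
  show ?case
  proof (cases "\<exists>p0\<in>P. \<not> vanishes_on (t p0 q) V")
    case False
    have "card Q < card P"
      using insert.hyps insert.prems(2) by simp
    then obtain c where "nontrivial_solution V (subalg X) P Q t c"
      using insert.IH[of P t] insert.prems by auto
    then show ?thesis
      using False by (intro exI[of _ c]) (auto simp: nontrivial_solution_def)
  next
    case True
    then obtain p0 where pivot: "p0 \<in> P" "\<not> vanishes_on (t p0 q) V"
      by blast
    define t' where "t' p r x = t p0 q x * t p r x - t p q x * t p0 r x" for p r x
    have "card Q < card (P - {p0})"
      using insert.hyps insert.prems(1,2) pivot(1) by simp
    moreover have "t' p r \<in> subalg X" if "p \<in> P" "r \<in> Q" for p r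
      unfolding t'_def using insert.prems(3) pivot(1) that
      by (intro subalg_diff subalg.mult) auto
    ultimately obtain c where reduced: "nontrivial_solution V (subalg X) (P - {p0}) Q t' c"
      using insert.IH[of "P - {p0}" t'] insert.prems(1) by auto
    show ?thesis
      using assms(1) insert.prems(1) pivot insert.prems(3) reduced[unfolded t'_def]
      by (rule nontrivial_solution_insert)
  qed
qed

lemma ex_nontrivial_solution_const:
  fixes t :: "'p \<Rightarrow> 'q \<Rightarrow> 'a::idom"
  assumes "finite Q" "finite P" "card Q < card P"
  obtains c where "\<exists>p\<in>P. c p \<noteq> 0" "\<And>q. q \<in> Q \<Longrightarrow> (\<Sum>p\<in>P. c p * t p q) = 0"
proof -
  have "integral_on {()} (subalg {} :: (unit \<Rightarrow> 'a) set)"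
    by (auto simp: integral_on_def)
  then obtain c where "nontrivial_solution {()} (subalg {}) P Q (\<lambda>p q _. t p q) c"
    using ex_nontrivial_solution[OF _ assms, of "{()}" "{}" "\<lambda>p q _. t p q"]
    by (auto simp: subalg.const)
  then show ?thesis
    using that[of "\<lambda>p. c p ()"] by (auto simp: nontrivial_solution_def)
qed

locale domain_extension =
  fixes V :: "'b set" and X Y :: "('b \<Rightarrow> 'a::idom) set"
  assumes integral: "integral_on V (subalg Y)"
    and subalg_base: "X \<subseteq> subalg Y"
begin

lemma base_le: "subalg X \<subseteq> subalg Y"
  by (rule subalg_least[OF subalg_base])

lemma integral_base: "integral_on V (subalg X)"
  by (rule integral_on_subset[OF integral base_le])

definition lin_indep :: "('b \<Rightarrow> 'a) set \<Rightarrow> bool" where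
  "lin_indep T \<longleftrightarrow> (\<forall>\<alpha>. (\<forall>t\<in>T. \<alpha> t \<in> subalg X) \<and> vanishes_on (\<lambda>x. \<Sum>t\<in>T. \<alpha> t x * t x) V \<longrightarrow>
     (\<forall>t\<in>T. vanishes_on (\<alpha> t) V))"

lemma lin_indepD:
  assumes "lin_indep T" "\<And>t. t \<in> T \<Longrightarrow> \<alpha> t \<in> subalg X"
    "\<And>x. x \<in> V \<Longrightarrow> (\<Sum>t\<in>T. \<alpha> t x * t x) = 0" "t \<in> T" "x \<in> V"
  shows "\<alpha> t x = 0"
  using assms(1)[unfolded lin_indep_def, THEN spec, of \<alpha>] assms(2-) by blast

definition span_over :: "('b \<Rightarrow> 'a) set \<Rightarrow> ('b \<Rightarrow> 'a) set \<Rightarrow> ('b \<Rightarrow> 'a) set" where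
  "span_over A T = {g. \<exists>\<alpha>. (\<forall>t\<in>T. \<alpha> t \<in> A) \<and> (\<forall>x\<in>V. g x = (\<Sum>t\<in>T. \<alpha> t x * t x))}"

definition fraction_span :: "('b \<Rightarrow> 'a) set \<Rightarrow> ('b \<Rightarrow> 'a) set" where
  "fraction_span T =
    {g. \<exists>w\<in>subalg X. \<not> vanishes_on w V \<and> (\<lambda>x. w x * g x) \<in> span_over (subalg X) T}"

lemma span_overI:
  "(\<And>t. t \<in> T \<Longrightarrow> \<alpha> t \<in> A) \<Longrightarrow> (\<And>x. x \<in> V \<Longrightarrow> g x = (\<Sum>t\<in>T. \<alpha> t x * t x)) \<Longrightarrow>
    g \<in> span_over A T"
  unfolding span_over_def by blast

lemma span_overE:
  assumes "g \<in> span_over A T"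
  obtains \<alpha> where "\<And>t. t \<in> T \<Longrightarrow> \<alpha> t \<in> A" "\<And>x. x \<in> V \<Longrightarrow> g x = (\<Sum>t\<in>T. \<alpha> t x * t x)"
proof -
  obtain \<alpha> where "(\<forall>t\<in>T. \<alpha> t \<in> A) \<and> (\<forall>x\<in>V. g x = (\<Sum>t\<in>T. \<alpha> t x * t x))"
    using assms unfolding span_over_def by blast
  then show ?thesis
    by (intro that[of \<alpha>]) auto
qed

lemma span_over_family:
  assumes "\<And>i. i \<in> J \<Longrightarrow> g i \<in> span_over A T"
  obtains M where "\<And>i t. i \<in> J \<Longrightarrow> t \<in> T \<Longrightarrow> M i t \<in> A"
    "\<And>i x. i \<in> J \<Longrightarrow> x \<in> V \<Longrightarrow> g i x = (\<Sum>t\<in>T. M i t x * t x)"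
proof -
  have "\<forall>i\<in>J. \<exists>\<alpha>. (\<forall>t\<in>T. \<alpha> t \<in> A) \<and> (\<forall>x\<in>V. g i x = (\<Sum>t\<in>T. \<alpha> t x * t x))"
    using assms unfolding span_over_def by blast
  from bchoice[OF this] obtain M
    where M: "\<forall>i\<in>J. (\<forall>t\<in>T. M i t \<in> A) \<and> (\<forall>x\<in>V. g i x = (\<Sum>t\<in>T. M i t x * t x))" ..
  show ?thesis
    by (rule that[of M]) (use M in simp_all)
qed

lemma span_over_base:
  assumes "finite T" "t \<in> T" "(\<lambda>_. 0) \<in> A" "(\<lambda>_. 1) \<in> A"
  shows "t \<in> span_over A T"
proof (rule span_overI)
  show "(\<lambda>_. if s = t then 1 else 0) \<in> A" for s
    using assms(3,4) by simp
  show "t x = (\<Sum>s\<in>T. (if s = t then 1 else 0) * s x)" for x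
    using assms(1,2) by (simp add: if_distrib[of "\<lambda>c. c * _"] cong: if_cong)
qed

lemma span_over_scale:
  assumes "g \<in> span_over A T" "\<And>\<alpha>. \<alpha> \<in> A \<Longrightarrow> (\<lambda>x. v x * \<alpha> x) \<in> B"
  shows "(\<lambda>x. v x * g x) \<in> span_over B T"
proof -
  obtain \<alpha> where \<alpha>: "\<And>t. t \<in> T \<Longrightarrow> \<alpha> t \<in> A" "\<And>x. x \<in> V \<Longrightarrow> g x = (\<Sum>t\<in>T. \<alpha> t x * t x)"
    by (rule span_overE[OF assms(1)]) (rule that)
  show ?thesis
    by (rule span_overI[of T "\<lambda>t x. v x * \<alpha> t x"])
      (simp_all add: \<alpha> assms(2) sum_distrib_left mult.assoc)
qed

lemma span_over_mult_base:
  "g \<in> span_over (subalg X) T \<Longrightarrow> v \<in> subalg X \<Longrightarrow> (\<lambda>x. v x * g x) \<in> span_over (subalg X) T"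
  by (erule span_over_scale) (rule subalg.mult)

lemma subset_fraction_span:
  assumes "finite T"
  shows "T \<subseteq> fraction_span T"
proof
  fix t
  assume "t \<in> T"
  then have "t \<in> span_over (subalg X) T"
    using assms by (intro span_over_base) auto
  then show "t \<in> fraction_span T"
    unfolding fraction_span_def using integral
    by (intro CollectI bexI[of _ "\<lambda>_. 1"]) (auto simp: integral_on_def)
qed

lemma fraction_span_if_dependent:
  assumes "finite T" "lin_indep T" "g \<notin> T" "\<not> lin_indep (insert g T)"
  shows "g \<in> fraction_span T"
proof -
  obtain \<alpha> where \<alpha>: "\<And>t. t \<in> insert g T \<Longrightarrow> \<alpha> t \<in> subalg X"
    "\<And>x. x \<in> V \<Longrightarrow> (\<Sum>t\<in>insert g T. \<alpha> t x * t x) = 0"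
    "\<exists>t\<in>insert g T. \<not> vanishes_on (\<alpha> t) V"
    using assms(4) unfolding lin_indep_def by blast
  have split: "\<alpha> g x * g x + (\<Sum>t\<in>T. \<alpha> t x * t x) = 0" if "x \<in> V" for x
    using \<alpha>(2)[OF that] assms(1,3) by simp
  have "\<not> vanishes_on (\<alpha> g) V"
  proof
    assume zero: "vanishes_on (\<alpha> g) V"
    then have "vanishes_on (\<lambda>x. \<Sum>t\<in>T. \<alpha> t x * t x) V"
      using split by auto
    then show False
      using assms(2) \<alpha>(1,3) zero unfolding lin_indep_def by blast
  qed
  moreover have "(\<lambda>x. \<alpha> g x * g x) \<in> span_over (subalg X) T"
  proof (rule span_overI)
    show "(\<lambda>x. - \<alpha> t x) \<in> subalg X" if "t \<in> T" for t
      using \<alpha>(1) that by (intro subalg_minus) auto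
    show "\<alpha> g x * g x = (\<Sum>t\<in>T. - \<alpha> t x * t x)" if "x \<in> V" for x
      using split[OF that] by (simp add: sum_negf eq_neg_iff_add_eq_0)
  qed
  ultimately show ?thesis
    unfolding fraction_span_def using \<alpha>(1) by blast
qed

lemma maximal_lin_indep:
  assumes bound: "\<And>T. finite T \<Longrightarrow> T \<subseteq> S \<Longrightarrow> lin_indep T \<Longrightarrow> card T \<le> N"
  obtains T where "finite T" "T \<subseteq> S" "lin_indep T" "S \<subseteq> fraction_span T"
proof -
  define P where "P n \<longleftrightarrow> (\<exists>T. finite T \<and> T \<subseteq> S \<and> lin_indep T \<and> card T = n)" for n
  have "P 0"
    unfolding P_def by (intro exI[of _ "{}"]) (simp add: lin_indep_def)
  moreover have bounded: "n \<le> N" if "P n" for n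
    using that bound unfolding P_def by blast
  ultimately have "P (GREATEST n. P n)"
    by (rule GreatestI_nat)
  then obtain T where T: "finite T" "T \<subseteq> S" "lin_indep T" "card T = (GREATEST n. P n)"
    unfolding P_def by blast
  have "g \<in> fraction_span T" if "g \<in> S" for g
  proof (rule ccontr)
    assume g: "g \<notin> fraction_span T"
    then have "g \<notin> T" "lin_indep (insert g T)"
      using subset_fraction_span[OF T(1)] fraction_span_if_dependent[OF T(1,3)] by blast+
    then have "P (Suc (card T))"
      unfolding P_def using T that by (intro exI[of _ "insert g T"]) auto
    then have "Suc (card T) \<le> card T"
      unfolding T(4) by (rule Greatest_le_nat) (rule bounded)
    then show False
      by simp
  qed
  then show ?thesis
    using that[OF T(1-3)] by blast
qed

lemma common_denominator:
  assumes "finite S" "S \<subseteq> fraction_span T"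
  obtains w where "w \<in> subalg X" "\<not> vanishes_on w V"
    "\<And>g. g \<in> S \<Longrightarrow> (\<lambda>x. w x * g x) \<in> span_over (subalg X) T"
proof -
  have "\<exists>w\<in>subalg X. \<not> vanishes_on w V \<and> (\<forall>g\<in>S. (\<lambda>x. w x * g x) \<in> span_over (subalg X) T)"
    using assms
  proof (induction S rule: finite_induct)
    case empty
    then show ?case
      using integral by (intro bexI[of _ "\<lambda>_. 1"]) (auto simp: integral_on_def)
  next
    case (insert g S)
    have "S \<subseteq> fraction_span T"
      using insert.prems by simp
    from insert.IH[OF this] obtain w where w: "w \<in> subalg X" "\<not> vanishes_on w V"
      "\<forall>h\<in>S. (\<lambda>x. w x * h x) \<in> span_over (subalg X) T"
      by (elim bexE conjE)
    obtain v where v: "v \<in> subalg X" "\<not> vanishes_on v V"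
      "(\<lambda>x. v x * g x) \<in> span_over (subalg X) T"
      using insert.prems by (auto simp: fraction_span_def)
    have "(\<lambda>x. v x * w x * h x) \<in> span_over (subalg X) T" if h: "h \<in> insert g S" for h
    proof (cases "h = g")
      case True
      then show ?thesis
        using span_over_mult_base[OF v(3) w(1)] by (simp add: mult_ac)
    next
      case False
      then show ?thesis
        using span_over_mult_base[OF bspec[OF w(3), of h] v(1)] h by (simp add: mult_ac)
    qed
    moreover have "\<not> vanishes_on (\<lambda>x. v x * w x) V"
      by (rule integral_on_mult[OF integral_base v(1) w(1) v(2) w(2)])
    ultimately show ?case
      by (intro bexI[OF _ subalg.mult[OF v(1) w(1)]] conjI ballI)
  qed
  then obtain w where "w \<in> subalg X" "\<not> vanishes_on w V"
    "\<forall>g\<in>S. (\<lambda>x. w x * g x) \<in> span_over (subalg X) T"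
    by (elim bexE conjE)
  then show ?thesis
    by (intro that[of w]) (simp_all add: Ball_def)
qed

definition coefficients ::
    "('b \<Rightarrow> 'a) set \<Rightarrow> ('b \<Rightarrow> 'a) set \<Rightarrow> ('b \<Rightarrow> 'a) \<Rightarrow> (('b \<Rightarrow> 'a) \<Rightarrow> ('b \<Rightarrow> 'a) \<Rightarrow> 'b \<Rightarrow> 'a) \<Rightarrow> bool"
  where
  "coefficients S T w M \<longleftrightarrow> (\<forall>s\<in>S. \<forall>t\<in>T. M s t \<in> subalg X) \<and>
     (\<forall>s\<in>S. \<forall>x\<in>V. w x * s x = (\<Sum>t\<in>T. M s t x * t x))"

definition linear_functional :: "('b \<Rightarrow> 'a) set \<Rightarrow> (('b \<Rightarrow> 'a) \<Rightarrow> 'b \<Rightarrow> 'a) \<Rightarrow> bool" where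
  "linear_functional S \<Lambda> \<longleftrightarrow> (\<forall>s\<in>S. \<Lambda> s \<in> subalg X) \<and>
     (\<forall>L. set L \<subseteq> subalg X \<times> S \<longrightarrow> vanishes_on (\<lambda>x. \<Sum>p\<leftarrow>L. fst p x * snd p x) V \<longrightarrow>
        vanishes_on (\<lambda>x. \<Sum>p\<leftarrow>L. fst p x * \<Lambda> (snd p) x) V)"

lemma linear_functionalD:
  assumes "linear_functional S \<Lambda>"
  shows "s \<in> S \<Longrightarrow> \<Lambda> s \<in> subalg X"
    and "set L \<subseteq> subalg X \<times> S \<Longrightarrow> vanishes_on (\<lambda>x. \<Sum>p\<leftarrow>L. fst p x * snd p x) V \<Longrightarrow>
      vanishes_on (\<lambda>x. \<Sum>p\<leftarrow>L. fst p x * \<Lambda> (snd p) x) V"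
  using assms unfolding linear_functional_def by simp_all

lemma ex_coefficients:
  assumes "finite S"
  obtains T w M where "lin_indep T" "w \<in> subalg X" "\<not> vanishes_on w V" "coefficients S T w M"
proof -
  have "card T \<le> card S" if "T \<subseteq> S" for T
    using card_mono[OF assms that] .
  then obtain T where T: "finite T" "T \<subseteq> S" "lin_indep T" "S \<subseteq> fraction_span T"
    by (rule maximal_lin_indep)
  obtain w where w: "w \<in> subalg X" "\<not> vanishes_on w V"
    "\<And>s. s \<in> S \<Longrightarrow> (\<lambda>x. w x * s x) \<in> span_over (subalg X) T"
    by (rule common_denominator[OF assms T(4)]) (rule that)
  obtain M where "\<And>s t. s \<in> S \<Longrightarrow> t \<in> T \<Longrightarrow> M s t \<in> subalg X"
    "\<And>s x. s \<in> S \<Longrightarrow> x \<in> V \<Longrightarrow> w x * s x = (\<Sum>t\<in>T. M s t x * t x)"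
    by (rule span_over_family[of S "\<lambda>s x. w x * s x" "subalg X" T]) (erule w(3), rule that)
  then have "coefficients S T w M"
    unfolding coefficients_def by simp
  with T(3) w(1,2) show ?thesis
    by (rule that)
qed

lemma coefficients_sum_list:
  assumes "coefficients S T w M" "x \<in> V" "snd ` set L \<subseteq> S"
  shows "w x * (\<Sum>p\<leftarrow>L. fst p x * snd p x) =
    (\<Sum>t\<in>T. (\<Sum>p\<leftarrow>L. fst p x * M (snd p) t x) * t x)"
  using assms(3)
proof (induction L)
  case (Cons p L)
  have "w x * (\<Sum>p\<leftarrow>p # L. fst p x * snd p x) =
      fst p x * (w x * snd p x) + w x * (\<Sum>p\<leftarrow>L. fst p x * snd p x)"
    by (simp add: distrib_left mult.left_commute)
  also have "w x * snd p x = (\<Sum>t\<in>T. M (snd p) t x * t x)"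
    using assms(1,2) Cons.prems by (simp add: coefficients_def)
  also have "w x * (\<Sum>p\<leftarrow>L. fst p x * snd p x) =
      (\<Sum>t\<in>T. (\<Sum>p\<leftarrow>L. fst p x * M (snd p) t x) * t x)"
    using Cons by simp
  finally show ?case
    by (simp add: sum_distrib_left mult.assoc distrib_right sum.distrib)
qed simp

lemma coefficients_linear_functional:
  assumes M: "coefficients S T w M" and indep: "lin_indep T" and t: "t \<in> T"
  shows "linear_functional S (\<lambda>s. M s t)"
  unfolding linear_functional_def
proof (intro conjI allI impI ballI)
  show "M s t \<in> subalg X" if "s \<in> S" for s
    using M t that by (simp add: coefficients_def)
  fix L x
  assume L: "set L \<subseteq> subalg X \<times> S" and zero: "vanishes_on (\<lambda>x. \<Sum>p\<leftarrow>L. fst p x * snd p x) V"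
    and "x \<in> V"
  have "snd ` set L \<subseteq> S"
    using L by auto
  show "(\<Sum>p\<leftarrow>L. fst p x * M (snd p) t x) = 0"
  proof (rule lin_indepD[OF indep _ _ t \<open>x \<in> V\<close>])
    show "(\<lambda>x. \<Sum>p\<leftarrow>L. fst p x * M (snd p) t x) \<in> subalg X" if "t \<in> T" for t
      using L M that unfolding coefficients_def by (intro subalg_sum_list subalg.mult) auto
    show "(\<Sum>t\<in>T. (\<Sum>p\<leftarrow>L. fst p x * M (snd p) t x) * t x) = 0" if "x \<in> V" for x
      using coefficients_sum_list[OF M that \<open>snd ` set L \<subseteq> S\<close>] bspec[OF zero that] by simp
  qed
qed

lemma separating_functional:
  fixes N :: nat
  assumes "finite S"
    and a: "\<And>i. i < N \<Longrightarrow> a i \<in> subalg Y"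
    and b: "\<And>i. i < N \<Longrightarrow> b i \<in> subalg Y" "\<And>i. i < N \<Longrightarrow> b i \<in> S"
    and nonzero: "\<not> vanishes_on (\<lambda>x. \<Sum>i<N. a i x * b i x) V"
  obtains \<Lambda> where "linear_functional S \<Lambda>" "\<not> vanishes_on (\<lambda>x. \<Sum>i<N. a i x * \<Lambda> (b i) x) V"
proof -
  obtain T w M where indep: "lin_indep T" and w: "w \<in> subalg X" "\<not> vanishes_on w V"
    and M: "coefficients S T w M"
    by (rule ex_coefficients[OF assms(1)])
  have "\<exists>t\<in>T. \<not> vanishes_on (\<lambda>x. \<Sum>i<N. a i x * M (b i) t x) V"
  proof (rule ccontr)
    assume all_zero: "\<not> ?thesis"
    have "w x * (\<Sum>i<N. a i x * b i x) = 0" if "x \<in> V" for x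
    proof -
      have "w x * (\<Sum>i<N. a i x * b i x) = (\<Sum>t\<in>T. (\<Sum>i<N. a i x * M (b i) t x) * t x)"
        using coefficients_sum_list[OF M that, of "map (\<lambda>i. (a i, b i)) [0..<N]"] b(2)
        by (simp add: interv_sum_list_conv_sum_set_nat atLeast0LessThan o_def image_subset_iff)
      also have "\<dots> = 0"
        using all_zero that by (intro sum.neutral) simp
      finally show ?thesis .
    qed
    moreover have "(\<lambda>x. \<Sum>i<N. a i x * b i x) \<in> subalg Y"
      using a b(1) by (intro subalg_sum subalg.mult) simp_all
    then have "\<not> vanishes_on (\<lambda>x. w x * (\<Sum>i<N. a i x * b i x)) V"
      using w(1) base_le by (intro integral_on_mult[OF integral _ _ w(2) nonzero]) blast+
    ultimately show False
      by simp
  qed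
  then obtain t where t: "t \<in> T" "\<not> vanishes_on (\<lambda>x. \<Sum>i<N. a i x * M (b i) t x) V"
    by (elim bexE)
  show ?thesis
    by (rule that[OF coefficients_linear_functional[OF M indep t(1)] t(2)])
qed

end

context domain_extension
begin

definition diagonal_ideal :: "('b \<Rightarrow> 'b \<Rightarrow> 'a) set" where
  "diagonal_ideal = {W. \<exists>(n::nat) p \<alpha> r. (\<forall>i<n. \<alpha> i \<in> subalg X) \<and>
     (\<forall>x\<in>V. \<forall>y\<in>V. W x y = (\<Sum>i<n. p i x * (\<alpha> i x - \<alpha> i y) * r i y))}"

lemma diagonal_ideal_family:
  assumes "\<And>g. g \<in> T \<Longrightarrow> W g \<in> diagonal_ideal"
  shows "\<exists>(n :: _ \<Rightarrow> nat) p \<alpha> r. \<forall>g\<in>T. (\<forall>i<n g. \<alpha> g i \<in> subalg X) \<and>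
    (\<forall>x\<in>V. \<forall>y\<in>V. W g x y = (\<Sum>i<n g. p g i x * (\<alpha> g i x - \<alpha> g i y) * r g i y))"
proof -
  define expansion where "expansion g n p \<alpha> r \<longleftrightarrow> (\<forall>i<n::nat. \<alpha> i \<in> subalg X) \<and>
    (\<forall>x\<in>V. \<forall>y\<in>V. W g x y = (\<Sum>i<n. p i x * (\<alpha> i x - \<alpha> i y) * r i y))" for g n p \<alpha> r
  have "\<forall>g\<in>T. \<exists>n p \<alpha> r. expansion g n p \<alpha> r"
    using assms unfolding diagonal_ideal_def expansion_def by blast
  then have "\<exists>n p \<alpha> r. \<forall>g\<in>T. expansion g (n g) (p g) (\<alpha> g) (r g)"
    by metis
  then show ?thesis
    unfolding expansion_def .
qed

text \<open>Apply \<open>\<Lambda>\<close> to the second tensor factor; the right-hand side vanishes on the diagonal.\<close>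

lemma linear_functional_contraction:
  fixes N n :: nat
  assumes \<Lambda>: "linear_functional S \<Lambda>" and x: "x \<in> V"
    and b: "\<And>i. i < N \<Longrightarrow> b i \<in> S" "\<And>i. i < N \<Longrightarrow> (\<lambda>y. g y * b i y) \<in> S"
    and r: "\<And>i. i < n \<Longrightarrow> \<alpha> i \<in> subalg X" "\<And>i. i < n \<Longrightarrow> r i \<in> S"
    and identity: "\<And>y. y \<in> V \<Longrightarrow> (\<Sum>i<N. a i x * b i y) * (g x - g y) =
      (\<Sum>i<n. p i x * (\<alpha> i x - \<alpha> i y) * r i y)"
  shows "g x * (\<Sum>i<N. a i x * \<Lambda> (b i) x) = (\<Sum>i<N. a i x * \<Lambda> (\<lambda>y. g y * b i y) x)"
proof -
  define L where "L = map (\<lambda>i. (\<lambda>_. g x * a i x, b i)) [0..<N] @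
    map (\<lambda>i. (\<lambda>_. - a i x, \<lambda>y. g y * b i y)) [0..<N] @
    map (\<lambda>i. (\<lambda>y. - (p i x * (\<alpha> i x - \<alpha> i y)), r i)) [0..<n]"
  have "(\<lambda>y. - (p i x * (\<alpha> i x - \<alpha> i y))) \<in> subalg X" if "i < n" for i
    using r(1)[OF that] by (intro subalg_minus subalg.mult subalg_diff subalg.const)
  then have "set L \<subseteq> subalg X \<times> S"
    using b r(2) by (auto simp: L_def)
  moreover have "(\<Sum>q\<leftarrow>L. fst q y * snd q y) = (\<Sum>i<N. a i x * b i y) * (g x - g y) -
      (\<Sum>i<n. p i x * (\<alpha> i x - \<alpha> i y) * r i y)" for y
    by (simp add: L_def interv_sum_list_conv_sum_set_nat atLeast0LessThan o_def
        sum_distrib_left sum_distrib_right algebra_simps sum.distrib sum_subtractf sum_negf)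
  then have "vanishes_on (\<lambda>y. \<Sum>q\<leftarrow>L. fst q y * snd q y) V"
    using identity by simp
  ultimately have "(\<Sum>q\<leftarrow>L. fst q x * \<Lambda> (snd q) x) = 0"
    using linear_functionalD(2)[OF \<Lambda>, of L] x by blast
  then show ?thesis
    by (simp add: L_def interv_sum_list_conv_sum_set_nat atLeast0LessThan o_def
        sum_distrib_left sum_negf mult.assoc)
qed

lemma card_lin_indep_le_if_multiples:
  fixes N :: nat
  assumes G: "G \<in> subalg Y" "\<not> vanishes_on G V"
    and T: "finite T" "T \<subseteq> subalg Y" "lin_indep T"
    and \<beta>: "\<And>g i. g \<in> T \<Longrightarrow> i < N \<Longrightarrow> \<beta> g i \<in> subalg X"
    and multiple: "\<And>g x. g \<in> T \<Longrightarrow> x \<in> V \<Longrightarrow> g x * G x = (\<Sum>i<N. a i x * \<beta> g i x)"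
  shows "card T \<le> N"
proof (rule ccontr)
  assume "\<not> card T \<le> N"
  then obtain c where "nontrivial_solution V (subalg X) T {..<N} \<beta> c"
    using ex_nontrivial_solution[OF integral_base, of "{..<N}" T \<beta>] T(1) \<beta> by auto
  then have c: "\<forall>g\<in>T. c g \<in> subalg X" "\<exists>g\<in>T. \<not> vanishes_on (c g) V"
    "\<forall>i<N. vanishes_on (\<lambda>x. \<Sum>g\<in>T. c g x * \<beta> g i x) V"
    by (auto simp: nontrivial_solution_def)
  have "(\<Sum>g\<in>T. c g x * g x) = 0" if "x \<in> V" for x
  proof (rule integral_onD[OF integral G(1) _ G(2) _ that])
    show "(\<lambda>x. \<Sum>g\<in>T. c g x * g x) \<in> subalg Y"
      using c(1) base_le T(2) by (intro subalg_sum subalg.mult) auto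
    fix x
    assume x: "x \<in> V"
    have "G x * (\<Sum>g\<in>T. c g x * g x) = (\<Sum>g\<in>T. c g x * (g x * G x))"
      by (simp add: sum_distrib_left mult_ac)
    also have "\<dots> = (\<Sum>g\<in>T. \<Sum>i<N. a i x * (c g x * \<beta> g i x))"
      using x by (intro sum.cong refl) (simp add: multiple sum_distrib_left mult.left_commute)
    also have "\<dots> = (\<Sum>i<N. a i x * (\<Sum>g\<in>T. c g x * \<beta> g i x))"
      unfolding sum_distrib_left by (rule sum.swap)
    also have "\<dots> = 0"
      using c(3) x by simp
    finally show "G x * (\<Sum>g\<in>T. c g x * g x) = 0" .
  qed
  then have "c g x = 0" if "g \<in> T" "x \<in> V" for g x
    using lin_indepD[OF T(3) _ _ that, of c] c(1) by blast
  then show False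
    using c(2) by blast
qed

text \<open>
  With \<open>A = subalg X\<close> and \<open>R = subalg Y\<close>, the tensor \<open>u = \<Sum>a\<^sub>i \<otimes> b\<^sub>i\<close> kills all \<open>g \<otimes> 1 - 1 \<otimes> g\<close> in
  \<open>R \<otimes>\<^sub>A R\<close>. Contracting with an \<open>A\<close>-linear functional \<open>\<Lambda>\<close> gives \<open>G \<in> R\<close> with
  \<open>g G = \<Sum>\<Lambda>(g b\<^sub>i) a\<^sub>i\<close>, so all multiples of \<open>G\<close> are \<open>A\<close>-combinations of \<open>N\<close> functions.
\<close>

lemma card_lin_indep_le:
  fixes N :: nat
  assumes a: "\<And>i. i < N \<Longrightarrow> a i \<in> subalg Y" and b: "\<And>i. i < N \<Longrightarrow> b i \<in> subalg Y"
    and nonzero: "\<not> vanishes_on (\<lambda>x. \<Sum>i<N. a i x * b i x) V"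
    and kills: "\<And>g. g \<in> subalg Y \<Longrightarrow>
       (\<lambda>x y. (\<Sum>i<N. a i x * b i y) * (g x - g y)) \<in> diagonal_ideal"
    and T: "finite T" "T \<subseteq> subalg Y" "lin_indep T"
  shows "card T \<le> N"
proof -
  have "\<exists>(n :: _ \<Rightarrow> nat) p \<alpha> r. \<forall>g\<in>T. (\<forall>i<n g. \<alpha> g i \<in> subalg X) \<and>
      (\<forall>x\<in>V. \<forall>y\<in>V. (\<Sum>i<N. a i x * b i y) * (g x - g y) =
        (\<Sum>i<n g. p g i x * (\<alpha> g i x - \<alpha> g i y) * r g i y))"
    by (rule diagonal_ideal_family[of T "\<lambda>g x y. (\<Sum>i<N. a i x * b i y) * (g x - g y)"])
      (rule kills[OF subsetD[OF T(2)]])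
  then obtain n :: "('b \<Rightarrow> 'a) \<Rightarrow> nat" and p \<alpha> r where expansion:
    "\<forall>g\<in>T. (\<forall>i<n g. \<alpha> g i \<in> subalg X) \<and>
      (\<forall>x\<in>V. \<forall>y\<in>V. (\<Sum>i<N. a i x * b i y) * (g x - g y) =
        (\<Sum>i<n g. p g i x * (\<alpha> g i x - \<alpha> g i y) * r g i y))"
    by (elim exE)
  define S where "S = b ` {..<N} \<union>
    (\<Union>g\<in>T. (\<lambda>i y. g y * b i y) ` {..<N} \<union> r g ` {..<n g})"
  have "finite S"
    unfolding S_def using T(1) by auto
  have S: "b i \<in> S" "g \<in> T \<Longrightarrow> (\<lambda>y. g y * b i y) \<in> S" if "i < N" for i g
    unfolding S_def using that by auto
  obtain \<Lambda> where \<Lambda>: "linear_functional S \<Lambda>" "\<not> vanishes_on (\<lambda>x. \<Sum>i<N. a i x * \<Lambda> (b i) x) V"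
    by (rule separating_functional[OF \<open>finite S\<close> a b S(1) nonzero])
  show ?thesis
  proof (rule card_lin_indep_le_if_multiples[OF _ \<Lambda>(2) T])
    show "(\<lambda>x. \<Sum>i<N. a i x * \<Lambda> (b i) x) \<in> subalg Y"
      using a linear_functionalD(1)[OF \<Lambda>(1)] S(1) base_le by (intro subalg_sum subalg.mult) auto
    show "\<Lambda> (\<lambda>y. g y * b i y) \<in> subalg X" if "g \<in> T" "i < N" for g i
      using linear_functionalD(1)[OF \<Lambda>(1)] S(2) that by blast
    show "g x * (\<Sum>i<N. a i x * \<Lambda> (b i) x) = (\<Sum>i<N. a i x * \<Lambda> (\<lambda>y. g y * b i y) x)"
      if g: "g \<in> T" and x: "x \<in> V" for g x
    proof (rule linear_functional_contraction[OF \<Lambda>(1) x S(1) S(2)[OF _ g]])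
      show "\<alpha> g i \<in> subalg X" "r g i \<in> S" if "i < n g" for i
        using bspec[OF expansion g] g that by (auto simp: S_def)
    qed (use bspec[OF expansion g] x in auto)
  qed
qed

end

lemma finite_subset_degree_le:
  assumes "finite I" "finite F" "F \<subseteq> subalg (f ` I)"
  shows "\<exists>d. F \<subseteq> degree_le I f d"
  using assms(2,3)
proof (induction F rule: finite_induct)
  case (insert g F)
  then obtain d d' where "F \<subseteq> degree_le I f d" "g \<in> degree_le I f d'"
    using subalg_imp_degree_le[OF assms(1), of g f] by auto
  then have "insert g F \<subseteq> degree_le I f (d + d')"
    using degree_le_mono[OF assms(1)] by (meson insert_subset le_add1 le_add2 subset_iff)
  then show ?case
    by blast
qed simp

lemma binomial_outgrows:
  assumes "r < k"
  shows "\<exists>n. N * ((r + \<delta> * Suc n) choose r) < (k + n) choose k"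
proof -
  define C where "C = r + \<delta> * Suc k"
  define m where "m = N * C ^ r"
  define n where "n = k * m"
  have "r + \<delta> * Suc n \<le> C * Suc m"
    unfolding C_def n_def by (simp add: algebra_simps)
  then have "(r + \<delta> * Suc n) choose r \<le> (C * Suc m) ^ r"
    using binomial_le_pow[of r "r + \<delta> * Suc n"] power_mono[of "r + \<delta> * Suc n" "C * Suc m" r]
    by simp
  then have "N * ((r + \<delta> * Suc n) choose r) \<le> N * (C * Suc m) ^ r"
    by (rule mult_left_mono) simp
  also have "\<dots> = m * Suc m ^ r"
    by (simp only: m_def power_mult_distrib mult.assoc)
  also have "\<dots> < Suc m ^ Suc r"
    by simp
  also have "\<dots> \<le> Suc m ^ k"
    using assms by (intro power_increasing) auto
  also have "\<dots> \<le> (k + n) choose k"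
  proof -
    have "real (k + n) / real k = real (Suc m)"
      using assms by (simp add: n_def field_simps)
    then have "real (Suc m ^ k) \<le> real ((k + n) choose k)"
      using binomial_ge_n_over_k_pow_k[of k "k + n", where ?'a = real] by simp
    then show ?thesis
      by (simp only: of_nat_le_iff)
  qed
  finally show ?thesis
    by blast
qed

context domain_extension
begin

abbreviation base_degree_le :: "nat \<Rightarrow> ('b \<Rightarrow> 'a) set" where
  "base_degree_le \<equiv> degree_le X (\<lambda>f. f)"

lemma span_over_base_degree_le:
  assumes "finite X" "finite T" "finite F" "F \<subseteq> span_over (subalg X) T"
  shows "\<exists>\<delta>. F \<subseteq> span_over (base_degree_le \<delta>) T"
proof -
  obtain M where M: "\<And>g t. g \<in> F \<Longrightarrow> t \<in> T \<Longrightarrow> M g t \<in> subalg X"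
    "\<And>g x. g \<in> F \<Longrightarrow> x \<in> V \<Longrightarrow> g x = (\<Sum>t\<in>T. M g t x * t x)"
    by (rule span_over_family[of F "\<lambda>g. g" "subalg X" T]) (use assms(4) in blast, rule that)
  have "(\<lambda>(g, t). M g t) ` (F \<times> T) \<subseteq> subalg ((\<lambda>f. f) ` X)"
    using M(1) by auto
  then obtain \<delta> where "(\<lambda>(g, t). M g t) ` (F \<times> T) \<subseteq> base_degree_le \<delta>"
    using finite_subset_degree_le[of X "(\<lambda>(g, t). M g t) ` (F \<times> T)"] assms(1-3) by blast
  then have "g \<in> span_over (base_degree_le \<delta>) T" if "g \<in> F" for g
    using M(2) that by (intro span_overI[of T "M g"]) auto
  then show ?thesis
    by blast
qed

lemma span_over_degree_mult:
  assumes "finite X" "g \<in> span_over (base_degree_le D) T"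
    and "\<And>t. t \<in> T \<Longrightarrow> (\<lambda>x. v x * t x) \<in> span_over (base_degree_le \<delta>) T"
  shows "(\<lambda>x. v x * g x) \<in> span_over (base_degree_le (D + \<delta>)) T"
proof -
  obtain \<alpha> where \<alpha>: "\<And>t. t \<in> T \<Longrightarrow> \<alpha> t \<in> base_degree_le D"
    "\<And>x. x \<in> V \<Longrightarrow> g x = (\<Sum>t\<in>T. \<alpha> t x * t x)"
    by (rule span_overE[OF assms(2)]) (rule that)
  obtain M where M: "\<And>t s. t \<in> T \<Longrightarrow> s \<in> T \<Longrightarrow> M t s \<in> base_degree_le \<delta>"
    "\<And>t x. t \<in> T \<Longrightarrow> x \<in> V \<Longrightarrow> v x * t x = (\<Sum>s\<in>T. M t s x * s x)"
    by (rule span_over_family[of T "\<lambda>t x. v x * t x" "base_degree_le \<delta>" T])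
      (erule assms(3), rule that)
  show ?thesis
  proof (rule span_overI)
    show "(\<lambda>x. \<Sum>t\<in>T. \<alpha> t x * M t s x) \<in> base_degree_le (D + \<delta>)" if "s \<in> T" for s
      using \<alpha>(1) M(1) that by (intro degree_le_sum degree_le_mult[OF assms(1)])
    fix x
    assume x: "x \<in> V"
    have "v x * g x = (\<Sum>t\<in>T. \<alpha> t x * (v x * t x))"
      by (simp add: \<alpha>(2)[OF x] sum_distrib_left mult.left_commute)
    also have "\<dots> = (\<Sum>t\<in>T. \<Sum>s\<in>T. \<alpha> t x * M t s x * s x)"
      using M(2) x by (intro sum.cong refl) (simp add: sum_distrib_left mult.assoc)
    also have "\<dots> = (\<Sum>s\<in>T. (\<Sum>t\<in>T. \<alpha> t x * M t s x) * s x)"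
      unfolding sum_distrib_right by (rule sum.swap)
    finally show "v x * g x = \<dots>" .
  qed
qed

definition filtered_denominator ::
    "'i set \<Rightarrow> ('i \<Rightarrow> 'b \<Rightarrow> 'a) \<Rightarrow> ('b \<Rightarrow> 'a) set \<Rightarrow> ('b \<Rightarrow> 'a) \<Rightarrow> nat \<Rightarrow> bool" where
  "filtered_denominator I f T w \<delta> \<longleftrightarrow> w \<in> span_over (base_degree_le \<delta>) T \<and>
     (\<forall>t\<in>T. (\<lambda>x. w x * t x) \<in> span_over (base_degree_le \<delta>) T) \<and>
     (\<forall>i\<in>I. \<forall>t\<in>T. (\<lambda>x. w x * f i x * t x) \<in> span_over (base_degree_le \<delta>) T)"

lemma ex_filtered_denominator:
  assumes X: "finite X" and I: "finite I" and T: "finite T" "subalg Y \<subseteq> fraction_span T"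
    and sub: "T \<subseteq> subalg Y" "\<And>i. i \<in> I \<Longrightarrow> f i \<in> subalg Y"
  obtains w \<delta> where "w \<in> subalg X" "\<not> vanishes_on w V" "filtered_denominator I f T w \<delta>"
proof -
  define S where "S = insert (\<lambda>_. 1) (T \<union> (\<lambda>(i, t) x. f i x * t x) ` (I \<times> T))"
  have "finite S"
    unfolding S_def using I T(1) by simp
  have "S \<subseteq> subalg Y"
    unfolding S_def using sub by auto
  then have "S \<subseteq> fraction_span T"
    using T(2) by blast
  then obtain w where w: "w \<in> subalg X" "\<not> vanishes_on w V"
    "\<And>g. g \<in> S \<Longrightarrow> (\<lambda>x. w x * g x) \<in> span_over (subalg X) T"
    by (rule common_denominator[OF \<open>finite S\<close>]) (rule that)
  have "(\<lambda>g x. w x * g x) ` S \<subseteq> span_over (subalg X) T"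
    using w(3) by (rule image_subsetI)
  then obtain \<delta> where "(\<lambda>g x. w x * g x) ` S \<subseteq> span_over (base_degree_le \<delta>) T"
    using span_over_base_degree_le[OF X T(1) finite_imageI[OF \<open>finite S\<close>]] by meson
  then have wS: "(\<lambda>x. w x * g x) \<in> span_over (base_degree_le \<delta>) T" if "g \<in> S" for g
    using that by (rule subsetD[OF _ imageI])
  have "(\<lambda>x. w x * f i x * t x) \<in> span_over (base_degree_le \<delta>) T" if "i \<in> I" "t \<in> T" for i t
  proof -
    have "(\<lambda>x. f i x * t x) \<in> S"
      unfolding S_def using that by (intro insertI2 UnI2 image_eqI[of _ _ "(i, t)"]) simp_all
    from wS[OF this] show ?thesis
      by (simp add: mult.assoc)
  qed
  then have "filtered_denominator I f T w \<delta>"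
    using wS[of "\<lambda>_. 1"] wS by (simp add: filtered_denominator_def S_def)
  with w(1,2) show ?thesis
    by (rule that)
qed

lemma monomial_in_span_over:
  assumes "finite X" "finite I" and w: "filtered_denominator I f T w \<delta>" and "e \<in> exponents I n"
  shows "(\<lambda>x. w x ^ Suc n * monomial I f e x) \<in> span_over (base_degree_le (\<delta> * Suc n)) T"
  using assms(4)
proof (induction n arbitrary: e)
  case 0
  then show ?case
    using assms(2) w by (simp add: filtered_denominator_def)
next
  case (Suc n)
  show ?case
  proof (cases "e \<in> exponents I n")
    case True
    have "(\<lambda>x. w x * t x) \<in> span_over (base_degree_le \<delta>) T" if "t \<in> T" for t
      using w that by (simp add: filtered_denominator_def)
    from span_over_degree_mult[OF assms(1) Suc.IH[OF True] this] show ?thesis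
      by (simp add: mult_ac add.commute)
  next
    case False
    then have "sum e I \<noteq> 0"
      using Suc.prems by (auto simp: exponents_def)
    then obtain i where i: "i \<in> I" "e i \<noteq> 0"
      by (rule sum.not_neutral_contains_not_neutral)
    define e' where "e' = e(i := e i - 1)"
    have "e' \<in> exponents I n"
      unfolding e'_def using assms(2) i(1) Suc.prems i(2) by (rule upd_pred_in_exponents)
    moreover have "(\<lambda>x. w x * f i x * t x) \<in> span_over (base_degree_le \<delta>) T" if "t \<in> T" for t
      using w i(1) that by (simp add: filtered_denominator_def)
    ultimately have "(\<lambda>x. w x * f i x * (w x ^ Suc n * monomial I f e' x))
        \<in> span_over (base_degree_le (\<delta> * Suc n + \<delta>)) T"
      by (intro span_over_degree_mult[OF assms(1)] Suc.IH)
    moreover have "monomial I f e x = f i x * monomial I f e' x" for x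
      using monomial_Suc[OF assms(2) i(1), of f e' x] i(2) by (simp add: e'_def)
    ultimately show ?thesis
      by (simp add: mult_ac add.commute)
  qed
qed

lemma linear_relation_if_in_span_over:
  assumes "finite X" "finite T" "finite E" "card T * card (exponents X D) < card E"
    and "\<And>e. e \<in> E \<Longrightarrow> G e \<in> span_over (base_degree_le D) T"
  obtains c where "\<exists>e\<in>E. c e \<noteq> 0" "\<And>x. x \<in> V \<Longrightarrow> (\<Sum>e\<in>E. c e * G e x) = 0"
proof -
  let ?Q = "T \<times> exponents X D"
  obtain \<alpha> where \<alpha>: "\<And>e t. e \<in> E \<Longrightarrow> t \<in> T \<Longrightarrow> \<alpha> e t \<in> base_degree_le D"
    "\<And>e x. e \<in> E \<Longrightarrow> x \<in> V \<Longrightarrow> G e x = (\<Sum>t\<in>T. \<alpha> e t x * t x)"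
    by (rule span_over_family[of E G "base_degree_le D" T]) (erule assms(5), rule that)
  have "\<forall>p\<in>E \<times> T. \<exists>c. \<alpha> (fst p) (snd p) =
      (\<lambda>x. \<Sum>m\<in>exponents X D. c m * monomial X (\<lambda>f. f) m x)"
    using \<alpha>(1) unfolding degree_le_def by auto
  from bchoice[OF this] obtain \<kappa> where \<kappa>: "\<forall>p\<in>E \<times> T. \<alpha> (fst p) (snd p) =
      (\<lambda>x. \<Sum>m\<in>exponents X D. \<kappa> p m * monomial X (\<lambda>f. f) m x)" ..
  define \<tau> where "\<tau> e q = \<kappa> (e, fst q) (snd q)" for e q
  have \<tau>: "G e x = (\<Sum>q\<in>?Q. \<tau> e q * (monomial X (\<lambda>f. f) (snd q) x * fst q x))"
    if "e \<in> E" "x \<in> V" for e x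
  proof -
    have "G e x = (\<Sum>t\<in>T. \<Sum>m\<in>exponents X D. \<tau> e (t, m) * (monomial X (\<lambda>f. f) m x * t x))"
      unfolding \<alpha>(2)[OF that]
      by (intro sum.cong refl)
        (use \<kappa> that(1) in \<open>auto simp: \<tau>_def sum_distrib_right mult.assoc\<close>)
    then show ?thesis
      by (simp add: sum.cartesian_product case_prod_beta)
  qed
  have "finite ?Q" "card ?Q < card E"
    using assms(1,2,4) by (simp_all add: finite_exponents card_cartesian_product)
  then obtain c where c: "\<exists>e\<in>E. c e \<noteq> 0" "\<And>q. q \<in> ?Q \<Longrightarrow> (\<Sum>e\<in>E. c e * \<tau> e q) = 0"
    by (rule ex_nontrivial_solution_const[OF _ assms(3), of ?Q \<tau>]) (rule that)
  show ?thesis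
  proof (rule that[OF c(1)])
    fix x
    assume x: "x \<in> V"
    have "(\<Sum>e\<in>E. c e * G e x) =
        (\<Sum>e\<in>E. \<Sum>q\<in>?Q. c e * \<tau> e q * (monomial X (\<lambda>f. f) (snd q) x * fst q x))"
      using \<tau> x by (intro sum.cong refl) (simp add: sum_distrib_left mult.assoc)
    also have "\<dots> = (\<Sum>q\<in>?Q. (\<Sum>e\<in>E. c e * \<tau> e q) * (monomial X (\<lambda>f. f) (snd q) x * fst q x))"
      unfolding sum_distrib_right by (rule sum.swap)
    also have "\<dots> = 0"
      using c(2) by simp
    finally show "(\<Sum>e\<in>E. c e * G e x) = 0" .
  qed
qed

text \<open>
  Monomials of degree \<open>n\<close> in the \<open>f\<^sub>i\<close> have a denominator of degree linear in \<open>n\<close> over a maximal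
  independent set; compare the number of such monomials with the dimension of the space they span.
\<close>

lemma card_alg_indep_le:
  fixes N :: nat
  assumes X: "finite X"
    and rank: "\<And>T. finite T \<Longrightarrow> T \<subseteq> subalg Y \<Longrightarrow> lin_indep T \<Longrightarrow> card T \<le> N"
    and f: "finite I" "\<And>i. i \<in> I \<Longrightarrow> f i \<in> subalg Y" "alg_indep V I f"
  shows "card I \<le> card X"
proof (rule ccontr)
  assume "\<not> card I \<le> card X"
  obtain T where T: "finite T" "T \<subseteq> subalg Y" "lin_indep T" "subalg Y \<subseteq> fraction_span T"
    by (rule maximal_lin_indep[of "subalg Y" N]) (erule (2) rank, rule that)
  obtain w \<delta> where w: "w \<in> subalg X" "\<not> vanishes_on w V" "filtered_denominator I f T w \<delta>"
    by (rule ex_filtered_denominator[OF X f(1) T(1,4,2) f(2)])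
  obtain n where n: "card T * ((card X + \<delta> * Suc n) choose card X) < (card I + n) choose card I"
    using binomial_outgrows \<open>\<not> card I \<le> card X\<close> by (metis not_le)
  have "card T * card (exponents X (\<delta> * Suc n)) < card (exponents I n)"
    using n X f(1) by (simp only: card_exponents)
  then obtain c where c: "\<exists>e\<in>exponents I n. c e \<noteq> 0"
    "\<And>x. x \<in> V \<Longrightarrow> (\<Sum>e\<in>exponents I n. c e * (w x ^ Suc n * monomial I f e x)) = 0"
    by (rule linear_relation_if_in_span_over[OF X T(1) finite_exponents[OF f(1)]])
      (erule monomial_in_span_over[OF X f(1) w(3)], rule that)
  have "(\<Sum>e\<in>exponents I n. c e * monomial I f e x) = 0" if "x \<in> V" for x
  proof (rule integral_onD[OF integral _ _ _ _ that])
    show "(\<lambda>x. w x ^ Suc n) \<in> subalg Y"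
      using w(1) base_le by (intro subalg_power) blast
    show "\<not> vanishes_on (\<lambda>x. w x ^ Suc n) V"
      using integral_on_power[OF integral_base w(1,2)] .
    show "(\<lambda>x. \<Sum>e\<in>exponents I n. c e * monomial I f e x) \<in> subalg Y"
      by (intro subalg_sum subalg.mult subalg.const monomial_subalg f(2))
    show "w x ^ Suc n * (\<Sum>e\<in>exponents I n. c e * monomial I f e x) = 0" if "x \<in> V" for x
      using c(2)[OF that] by (simp add: sum_distrib_left mult_ac)
  qed
  then have "c e = 0" if "e \<in> exponents I n" for e
    using that by (rule alg_indepD[OF f(3)])
  then show False
    using c(1) by blast
qed

end

section \<open>Polynomial functions and Zariski-closed sets\<close>

definition coord :: "'n \<Rightarrow> 'a ^ 'n \<Rightarrow> 'a" where
  "coord j x = x $ j"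

abbreviation polyfun :: "'n set \<Rightarrow> ('a::comm_ring_1 ^ 'n \<Rightarrow> 'a) set" where
  "polyfun T \<equiv> subalg (coord ` T)"

lemma coord_polyfun: "j \<in> T \<Longrightarrow> coord j \<in> polyfun T"
  by (auto intro: subalg.gen)

lemma nth_polyfun: "j \<in> T \<Longrightarrow> (\<lambda>x. x $ j) \<in> polyfun T"
  using coord_polyfun[of j T] by (simp add: coord_def[abs_def])

lemma mvpoly_eval_superset:
  assumes "finite A" "Poly_Mapping.keys p \<subseteq> A"
  shows "mvpoly_eval p x =
    (\<Sum>e\<in>A. Poly_Mapping.lookup p e * monomial UNIV coord (Poly_Mapping.lookup e) x)"
  unfolding mvpoly_eval_def monomial_def coord_def using assms
  by (intro sum.mono_neutral_left) (auto simp: in_keys_iff)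

lemma mvpoly_eval_add: "mvpoly_eval (p + q) x = mvpoly_eval p x + mvpoly_eval q x"
  using Poly_Mapping.keys_add[of p q]
  by (simp add: mvpoly_eval_superset[of "Poly_Mapping.keys p \<union> Poly_Mapping.keys q"]
      lookup_add distrib_right sum.distrib)

lemma mvpoly_eval_sum: "mvpoly_eval (\<Sum>i\<in>A. p i) x = (\<Sum>i\<in>A. mvpoly_eval (p i) x)"
  by (induction A rule: infinite_finite_induct)
    (simp_all add: mvpoly_eval_add mvpoly_eval_def[of 0])

lemma mvpoly_eval_single:
  "mvpoly_eval (Poly_Mapping.single e c) x = c * monomial UNIV coord (Poly_Mapping.lookup e) x"
  by (simp add: mvpoly_eval_superset[of "{e}"])

lemma range_mvpoly_eval: "range mvpoly_eval = (polyfun UNIV :: ('a::comm_ring_1 ^ 'n \<Rightarrow> 'a) set)"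
proof (intro equalityI subsetI)
  fix f :: "'a ^ 'n \<Rightarrow> 'a"
  assume "f \<in> range mvpoly_eval"
  then show "f \<in> polyfun UNIV"
    by (auto simp: mvpoly_eval_def[abs_def]
        intro!: subalg_sum subalg.mult subalg_prod subalg_power nth_polyfun)
next
  fix f :: "'a ^ 'n \<Rightarrow> 'a"
  assume "f \<in> polyfun UNIV"
  then obtain d c where f: "f = (\<lambda>x. \<Sum>e\<in>exponents UNIV d. c e * monomial UNIV coord e x)"
    using subalg_imp_degree_le[of UNIV f coord] by (auto elim!: degree_leE)
  have "f = mvpoly_eval (\<Sum>e\<in>exponents UNIV d. Poly_Mapping.single (Abs_poly_mapping e) (c e))"
    by (simp add: f fun_eq_iff mvpoly_eval_sum mvpoly_eval_single lookup_Abs_poly_mapping)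
  then show "f \<in> range mvpoly_eval"
    by blast
qed

lemma zariski_closed_iff:
  "zariski_closed V \<longleftrightarrow> (\<exists>S \<subseteq> polyfun UNIV. V = {x. \<forall>f\<in>S. f x = 0})"
proof -
  have "zariski_closed V \<longleftrightarrow> (\<exists>P. V = {x. \<forall>f\<in>mvpoly_eval ` P. f x = 0})"
    by (simp add: zariski_closed_def)
  then show ?thesis
    by (simp add: subset_image_iff flip: range_mvpoly_eval) blast
qed

lemma zariski_closed_Int_zeros:
  assumes "zariski_closed V" "f \<in> polyfun UNIV"
  shows "zariski_closed {x\<in>V. f x = 0}"
proof -
  obtain S where "S \<subseteq> polyfun UNIV" "V = {x. \<forall>f\<in>S. f x = 0}"
    using assms(1) by (auto simp: zariski_closed_iff)
  then show ?thesis
    unfolding zariski_closed_iff using assms(2) by (intro exI[of _ "insert f S"]) auto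
qed

lemma zariski_closed_zeros: "f \<in> polyfun UNIV \<Longrightarrow> zariski_closed {x. f x = 0}"
  unfolding zariski_closed_iff by (intro exI[of _ "{f}"]) auto

lemma zariski_closed_separation:
  assumes "zariski_closed V" "x \<notin> V"
  obtains f where "f \<in> polyfun UNIV" "vanishes_on f V" "f x \<noteq> 0"
  using assms by (auto simp: zariski_closed_iff)

lemma zariski_irreducible_iff:
  "zariski_irreducible V \<longleftrightarrow> zariski_closed V \<and> integral_on V (polyfun UNIV)"
proof (intro iffI conjI)
  assume V: "zariski_irreducible V"
  then show closed: "zariski_closed V"
    by (simp add: zariski_irreducible_def)
  show "integral_on V (polyfun UNIV)"
  proof (rule integral_onI)
    show "V \<noteq> {}"
      using V by (simp add: zariski_irreducible_def)
    fix f g :: "'a ^ 'b \<Rightarrow> 'a"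
    assume fg: "f \<in> polyfun UNIV" "g \<in> polyfun UNIV" "vanishes_on (\<lambda>x. f x * g x) V"
    have "V = {x\<in>V. f x = 0} \<union> {x\<in>V. g x = 0}"
      using fg(3) by auto
    then have "V = {x\<in>V. f x = 0} \<or> V = {x\<in>V. g x = 0}"
      using V zariski_closed_Int_zeros[OF closed] fg(1,2) unfolding zariski_irreducible_def by blast
    then show "vanishes_on f V \<or> vanishes_on g V"
      by blast
  qed
next
  assume V: "zariski_closed V \<and> integral_on V (polyfun UNIV)"
  have "V = A \<or> V = B" if AB: "zariski_closed A" "zariski_closed B" "V = A \<union> B" for A B
  proof (rule ccontr)
    assume "\<not> ?thesis"
    then obtain a b where ab: "a \<in> V" "a \<notin> A" "b \<in> V" "b \<notin> B"
      using AB(3) by blast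
    obtain f where f: "f \<in> polyfun UNIV" "vanishes_on f A" "f a \<noteq> 0"
      using zariski_closed_separation[OF AB(1) ab(2)] .
    obtain g where g: "g \<in> polyfun UNIV" "vanishes_on g B" "g b \<noteq> 0"
      using zariski_closed_separation[OF AB(2) ab(4)] .
    have "vanishes_on (\<lambda>x. f x * g x) V"
      using AB(3) f(2) g(2) by auto
    then show False
      using integral_on_mult[OF conjunct2[OF V] f(1) g(1)] f(3) g(3) ab(1,3) by blast
  qed
  then show "zariski_irreducible V"
    using V by (auto simp: zariski_irreducible_def integral_on_def)
qed

lemma polyfun_line:
  fixes x v :: "'a::comm_ring_1 ^ 'n"
  assumes "f \<in> polyfun UNIV"
  shows "\<exists>p. \<forall>t. f (x + t *s v) = poly p t"
  using assms
proof (induction rule: subalg.induct)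
  case (const c)
  show ?case
    by (rule exI[of _ "[:c:]"]) simp
next
  case (gen f)
  then obtain j where "f = coord j"
    by blast
  then show ?case
    by (intro exI[of _ "[:x $ j, v $ j:]"]) (simp add: coord_def)
next
  case (add f g)
  then show ?case
    by (metis poly_add)
next
  case (mult f g)
  then show ?case
    by (metis poly_mult)
qed

text \<open>Two functions that are nonzero at \<open>x\<close> and \<open>y\<close> are both nonzero somewhere on the line \<open>x y\<close>.\<close>

lemma integral_on_affine:
  fixes V :: "('a::field ^ 'n) set"
  assumes "infinite (UNIV :: 'a set)" "V \<noteq> {}"
    and line: "\<And>x y t. x \<in> V \<Longrightarrow> y \<in> V \<Longrightarrow> x + t *s (y - x) \<in> V"
  shows "integral_on V (polyfun UNIV)"
proof (rule integral_onI[OF assms(2)])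
  fix f g :: "'a ^ 'n \<Rightarrow> 'a"
  assume f: "f \<in> polyfun UNIV" and g: "g \<in> polyfun UNIV"
    and zero: "vanishes_on (\<lambda>x. f x * g x) V"
  show "vanishes_on f V \<or> vanishes_on g V"
  proof (rule ccontr)
    assume "\<not> ?thesis"
    then obtain x y where xy: "x \<in> V" "f x \<noteq> 0" "y \<in> V" "g y \<noteq> 0"
      by blast
    obtain p where p: "\<And>t. f (x + t *s (y - x)) = poly p t"
      using polyfun_line[OF f] by blast
    obtain q where q: "\<And>t. g (x + t *s (y - x)) = poly q t"
      using polyfun_line[OF g] by blast
    have "p \<noteq> 0" "q \<noteq> 0"
      using p[of 0] q[of 1] xy by auto
    then have "finite {t. poly (p * q) t = 0}"
      by (intro poly_roots_finite) simp
    then obtain t where "poly (p * q) t \<noteq> 0"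
      using ex_new_if_finite[OF assms(1)] by blast
    then have "f (x + t *s (y - x)) * g (x + t *s (y - x)) \<noteq> 0"
      unfolding p q poly_mult .
    then show False
      using zero line[OF xy(1,3)] by blast
  qed
qed

lemma infinite_UNIV_alg_closed: "infinite (UNIV :: 'a::alg_closed_field set)"
proof
  assume fin: "finite (UNIV :: 'a set)"
  define p :: "'a poly" where "p = (\<Prod>a\<in>UNIV. [:-a, 1:]) + 1"
  have "poly p x = 1" for x
    using fin by (simp add: p_def poly_prod prod_zero_iff)
  moreover have "degree (\<Prod>a\<in>(UNIV :: 'a set). [:-a, 1:]) = card (UNIV :: 'a set)"
    by (subst degree_prod_eq_sum_degree) auto
  then have "degree p > 0"
    unfolding p_def using fin by (subst degree_add_eq_left) (auto simp: card_gt_0_iff)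
  ultimately show False
    using alg_closed_imp_poly_has_root[of p] by auto
qed

section \<open>Difference quotients and gradients\<close>

definition dot :: "'a::comm_ring_1 ^ 'n \<Rightarrow> 'a ^ 'n \<Rightarrow> 'a" where
  "dot v w = (\<Sum>i\<in>UNIV. v $ i * w $ i)"

lemma dot_add_left: "dot (u + v) w = dot u w + dot v w"
  by (simp add: dot_def distrib_right sum.distrib)

lemma dot_add_right: "dot u (v + w) = dot u v + dot u w"
  by (simp add: dot_def distrib_left sum.distrib)

lemma dot_diff_right: "dot u (v - w) = dot u v - dot u w"
  by (simp add: dot_def right_diff_distrib sum_subtractf)

lemma dot_scale_left: "dot (c *s v) w = c * dot v w"
  by (simp add: dot_def sum_distrib_left mult.assoc)

lemma dot_scale_right: "dot v (c *s w) = c * dot v w"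
  by (simp add: dot_def sum_distrib_left mult.left_commute)

lemma dot_zero_left [simp]: "dot 0 w = 0"
  by (simp add: dot_def)

lemma dot_zero_right [simp]: "dot v 0 = 0"
  by (simp add: dot_def)

lemma dot_axis_left [simp]: "dot (axis j 1) w = w $ j"
  by (simp add: dot_def axis_def if_distrib[of "\<lambda>c. c * _"] cong: if_cong)

lemma dot_axis_right [simp]: "dot v (axis j 1) = v $ j"
  by (simp add: dot_def axis_def if_distrib[of "\<lambda>c. _ * c"] cong: if_cong)

lemma matrix_vector_mult_nth: "(A *v w) $ i = dot (A $ i) w"
  by (simp add: matrix_vector_mult_def dot_def)

lemma dot_vector_matrix_mult: "dot (v v* A) w = dot v (A *v w)"
  unfolding dot_def matrix_vector_mult_def vector_matrix_mult_def
  by (simp add: sum_distrib_left sum_distrib_right, subst sum.swap) (simp add: mult_ac)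

abbreviation bipolyfun :: "(('a::comm_ring_1 ^ 'n) \<times> ('a ^ 'n) \<Rightarrow> 'a) set" where
  "bipolyfun \<equiv> subalg (range (\<lambda>j p. coord j (fst p)) \<union> range (\<lambda>j p. coord j (snd p)))"

lemma polyfun_fst: "f \<in> polyfun UNIV \<Longrightarrow> (\<lambda>p. f (fst p)) \<in> bipolyfun"
  by (erule subalg_comp[where \<rho> = fst]) (auto intro: subalg.gen)

lemma polyfun_snd: "f \<in> polyfun UNIV \<Longrightarrow> (\<lambda>p. f (snd p)) \<in> bipolyfun"
  by (erule subalg_comp[where \<rho> = snd]) (auto intro: subalg.gen)

lemma bipolyfun_diagonal: "B \<in> bipolyfun \<Longrightarrow> (\<lambda>x. B (x, x)) \<in> polyfun UNIV"
  by (erule subalg_comp[where \<rho> = "\<lambda>x. (x, x)"]) (auto intro: subalg.gen)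

lemma bipolyfun_map:
  assumes "B \<in> bipolyfun" "\<And>j. (\<lambda>x. \<phi> x $ j) \<in> polyfun UNIV"
  shows "(\<lambda>p. B (\<phi> (fst p), \<phi> (snd p))) \<in> bipolyfun"
  using assms(1)
  by (rule subalg_comp)
    (use polyfun_fst[OF assms(2)] polyfun_snd[OF assms(2)] in \<open>auto simp: coord_def\<close>)

lemma sum_list_mult_sum_list:
  fixes f :: "'b \<Rightarrow> 'a::comm_semiring_0"
  shows "(\<Sum>q\<leftarrow>K. f q) * (\<Sum>q\<leftarrow>L. g q) = (\<Sum>q\<leftarrow>List.product K L. f (fst q) * g (snd q))"
  by (induction K) (simp_all add: distrib_right sum_list_const_mult o_def)

definition tensor_expansion ::
    "(('a::comm_ring_1 ^ 'n) \<times> ('a ^ 'n) \<Rightarrow> 'a) \<Rightarrow>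
      (('a ^ 'n \<Rightarrow> 'a) \<times> ('a ^ 'n \<Rightarrow> 'a)) list \<Rightarrow> bool" where
  "tensor_expansion B L \<longleftrightarrow> set L \<subseteq> polyfun UNIV \<times> polyfun UNIV \<and>
     (\<forall>x y. B (x, y) = (\<Sum>q\<leftarrow>L. fst q x * snd q y))"

lemma tensor_expansion_mult:
  assumes "tensor_expansion B K" "tensor_expansion C L"
  shows "\<exists>M. tensor_expansion (\<lambda>p. B p * C p) M"
proof -
  define M where
    "M = map (\<lambda>(q, r). (\<lambda>x. fst q x * fst r x, \<lambda>y. snd q y * snd r y)) (List.product K L)"
  have "set M \<subseteq> polyfun UNIV \<times> polyfun UNIV"
    using assms unfolding tensor_expansion_def M_def by fastforce
  moreover have "B (x, y) * C (x, y) = (\<Sum>q\<leftarrow>M. fst q x * snd q y)" for x y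
    using assms
    by (simp add: tensor_expansion_def M_def sum_list_mult_sum_list case_prod_beta o_def mult_ac)
  ultimately show ?thesis
    unfolding tensor_expansion_def by blast
qed

lemma bipolyfun_tensor_expansion:
  assumes "B \<in> bipolyfun"
  shows "\<exists>L. tensor_expansion B L"
  using assms
proof (induction rule: subalg.induct)
  case (const c)
  show ?case
    by (rule exI[of _ "[(\<lambda>_. c, \<lambda>_. 1)]"]) (auto simp: tensor_expansion_def)
next
  case (gen B)
  then consider j where "B = (\<lambda>p. coord j (fst p))" | j where "B = (\<lambda>p. coord j (snd p))"
    by blast
  then show ?case
  proof cases
    case (1 j)
    then show ?thesis
      by (intro exI[of _ "[(coord j, \<lambda>_. 1)]"])
        (auto simp: tensor_expansion_def intro: coord_polyfun)
  next
    case (2 j)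
    then show ?thesis
      by (intro exI[of _ "[(\<lambda>_. 1, coord j)]"])
        (auto simp: tensor_expansion_def intro: coord_polyfun)
  qed
next
  case (add B C)
  then obtain K L where "tensor_expansion B K" "tensor_expansion C L"
    by blast
  then show ?case
    by (intro exI[of _ "K @ L"]) (simp add: tensor_expansion_def)
next
  case (mult B C)
  then show ?case
    using tensor_expansion_mult by blast
qed

lemma bipolyfun_expansion:
  assumes "B \<in> bipolyfun"
  obtains n :: nat and p r where "\<And>i. i < n \<Longrightarrow> p i \<in> polyfun UNIV"
    "\<And>i. i < n \<Longrightarrow> r i \<in> polyfun UNIV" "\<And>x y. B (x, y) = (\<Sum>i<n. p i x * r i y)"
proof -
  obtain L where L: "set L \<subseteq> polyfun UNIV \<times> polyfun UNIV"
    "\<And>x y. B (x, y) = (\<Sum>q\<leftarrow>L. fst q x * snd q y)"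
    using bipolyfun_tensor_expansion[OF assms] by (auto simp: tensor_expansion_def)
  show ?thesis
  proof (rule that[of "length L" "\<lambda>i. fst (L ! i)" "\<lambda>i. snd (L ! i)"])
    show "B (x, y) = (\<Sum>i<length L. fst (L ! i) x * snd (L ! i) y)" for x y
      by (simp add: L(2) sum_list_sum_nth atLeast0LessThan)
  qed (use L(1) nth_mem in fastforce)+
qed

definition difference_quotient ::
    "('a::comm_ring_1 ^ 'n \<Rightarrow> 'a) \<Rightarrow> (('a ^ 'n) \<times> ('a ^ 'n) \<Rightarrow> 'a ^ 'n) \<Rightarrow> bool" where
  "difference_quotient f D \<longleftrightarrow> (\<forall>j. (\<lambda>p. D p $ j) \<in> bipolyfun) \<and>
     (\<forall>x y. f x - f y = dot (D (x, y)) (x - y))"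

definition has_gradient ::
    "('a::comm_ring_1 ^ 'n \<Rightarrow> 'a) \<Rightarrow> ('a ^ 'n \<Rightarrow> 'a ^ 'n) \<Rightarrow> bool" where
  "has_gradient f f' \<longleftrightarrow> (\<exists>D. difference_quotient f D \<and> f' = (\<lambda>x. D (x, x)))"

lemma has_gradientI:
  "difference_quotient f D \<Longrightarrow> f' = (\<lambda>x. D (x, x)) \<Longrightarrow> has_gradient f f'"
  unfolding has_gradient_def by blast

lemma has_gradientE:
  assumes "has_gradient f f'"
  obtains D where "difference_quotient f D" "f' = (\<lambda>x. D (x, x))"
  using assms unfolding has_gradient_def by blast

lemma has_gradient_polyfun:
  assumes "has_gradient f f'"
  shows "(\<lambda>x. f' x $ j) \<in> polyfun UNIV"
proof -
  obtain D where D: "difference_quotient f D" "f' = (\<lambda>x. D (x, x))"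
    using assms by (rule has_gradientE)
  then show ?thesis
    using bipolyfun_diagonal[of "\<lambda>p. D p $ j"] by (simp add: difference_quotient_def)
qed

lemma has_gradient_const: "has_gradient (\<lambda>_. c) (\<lambda>_. 0)"
  by (rule has_gradientI[of _ "\<lambda>_. 0"]) (auto simp: difference_quotient_def)

lemma has_gradient_coord: "has_gradient (coord j) (\<lambda>_. axis j 1)"
  by (rule has_gradientI[of _ "\<lambda>_. axis j 1"]) (auto simp: difference_quotient_def coord_def)

lemma has_gradient_add:
  assumes "has_gradient f f'" "has_gradient g g'"
  shows "has_gradient (\<lambda>x. f x + g x) (\<lambda>x. f' x + g' x)"
proof -
  obtain D E where D: "difference_quotient f D" "f' = (\<lambda>x. D (x, x))"
    and E: "difference_quotient g E" "g' = (\<lambda>x. E (x, x))"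
    using assms by (auto elim!: has_gradientE)
  have "difference_quotient (\<lambda>x. f x + g x) (\<lambda>p. D p + E p)"
    using D(1) E(1) by (auto simp: difference_quotient_def dot_add_left add_diff_add)
  then show ?thesis
    by (rule has_gradientI) (simp add: D(2) E(2))
qed

lemma has_gradient_mult:
  assumes "f \<in> polyfun UNIV" "g \<in> polyfun UNIV" "has_gradient f f'" "has_gradient g g'"
  shows "has_gradient (\<lambda>x. f x * g x) (\<lambda>x. f x *s g' x + g x *s f' x)"
proof -
  obtain D E where D: "difference_quotient f D" "f' = (\<lambda>x. D (x, x))"
    and E: "difference_quotient g E" "g' = (\<lambda>x. E (x, x))"
    using assms(3,4) by (auto elim!: has_gradientE)
  have "f x * g x - f y * g y = f x * (g x - g y) + g y * (f x - f y)" for x y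
    by (simp add: algebra_simps)
  then have "f x * g x - f y * g y = dot (f x *s E (x, y) + g y *s D (x, y)) (x - y)" for x y
    using D(1) E(1) by (simp add: difference_quotient_def dot_add_left dot_scale_left)
  moreover have "(\<lambda>p. f (fst p) * E p $ j + g (snd p) * D p $ j) \<in> bipolyfun" for j
    using D(1) E(1) unfolding difference_quotient_def
    by (intro subalg.add subalg.mult polyfun_fst polyfun_snd assms(1,2)) simp_all
  ultimately have "difference_quotient (\<lambda>x. f x * g x) (\<lambda>p. f (fst p) *s E p + g (snd p) *s D p)"
    by (simp add: difference_quotient_def)
  then show ?thesis
    by (rule has_gradientI) (simp add: D(2) E(2))
qed

lemma has_gradient_scale:
  assumes "has_gradient f f'"
  shows "has_gradient (\<lambda>x. c * f x) (\<lambda>x. c *s f' x)"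
proof -
  obtain D where D: "difference_quotient f D" "f' = (\<lambda>x. D (x, x))"
    using assms by (rule has_gradientE)
  have "difference_quotient (\<lambda>x. c * f x) (\<lambda>p. c *s D p)"
    using D(1) by (auto simp: difference_quotient_def dot_scale_left simp flip: right_diff_distrib)
  then show ?thesis
    by (rule has_gradientI) (simp add: D(2))
qed

lemma has_gradient_sum:
  "(\<And>i. i \<in> A \<Longrightarrow> has_gradient (f i) (f' i)) \<Longrightarrow>
    has_gradient (\<lambda>x. \<Sum>i\<in>A. f i x) (\<lambda>x. \<Sum>i\<in>A. f' i x)"
  by (induction A rule: infinite_finite_induct)
    (simp_all add: has_gradient_const has_gradient_add)

lemma polyfun_imp_has_gradient:
  assumes "f \<in> polyfun UNIV"
  shows "\<exists>f'. has_gradient f f'"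
  using assms
proof (induction rule: subalg.induct)
  case (const c)
  then show ?case
    using has_gradient_const by blast
next
  case (gen f)
  then show ?case
    using has_gradient_coord by blast
next
  case (add f g)
  then show ?case
    using has_gradient_add by blast
next
  case (mult f g)
  then show ?case
    using has_gradient_mult by blast
qed

lemma affine_map_polyfun:
  fixes A :: "'a::comm_ring_1 ^ 'n ^ 'm"
  shows "(\<lambda>x. (A *v x + b) $ j) \<in> polyfun UNIV"
  unfolding matrix_vector_mult_def
  by (simp, intro subalg.add subalg_sum subalg.mult subalg.const nth_polyfun UNIV_I)

lemma has_gradient_comp_affine:
  fixes A :: "'a::comm_ring_1 ^ 'n ^ 'm"
  assumes "has_gradient f f'"
  shows "has_gradient (\<lambda>x. f (A *v x + b)) (\<lambda>x. f' (A *v x + b) v* A)"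
proof -
  define \<phi> where "\<phi> x = A *v x + b" for x
  obtain D where D: "difference_quotient f D" "f' = (\<lambda>x. D (x, x))"
    using assms by (rule has_gradientE)
  have "(\<lambda>x. \<phi> x $ j) \<in> polyfun UNIV" for j
    unfolding \<phi>_def by (rule affine_map_polyfun)
  then have "(\<lambda>p. D (\<phi> (fst p), \<phi> (snd p)) $ j) \<in> bipolyfun" for j
    using bipolyfun_map[of "\<lambda>p. D p $ j" \<phi>] D(1) by (simp add: difference_quotient_def)
  then have "(\<lambda>p. (D (\<phi> (fst p), \<phi> (snd p)) v* A) $ j) \<in> bipolyfun" for j
    unfolding vector_matrix_mult_def by (simp, intro subalg_sum subalg.mult subalg.const)
  moreover have "\<phi> x - \<phi> y = A *v (x - y)" for x y
    by (simp add: \<phi>_def matrix_vector_mult_diff_distrib)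
  ultimately have "difference_quotient (\<lambda>x. f (\<phi> x)) (\<lambda>p. D (\<phi> (fst p), \<phi> (snd p)) v* A)"
    using D(1) by (simp add: difference_quotient_def dot_vector_matrix_mult)
  then show ?thesis
    unfolding \<phi>_def by (rule has_gradientI) (simp add: D(2) \<phi>_def)
qed

section \<open>Separable relations of minimal degree\<close>

definition monomial_partial ::
    "'i set \<Rightarrow> ('i \<Rightarrow> 'b \<Rightarrow> 'a::comm_ring_1) \<Rightarrow> 'i \<Rightarrow> ('i \<Rightarrow> nat) \<Rightarrow> 'b \<Rightarrow> 'a" where
  "monomial_partial I f l e x = of_nat (e l) * monomial I f (e(l := e l - 1)) x"

lemma monomial_partial_Suc:
  assumes "finite I" "i \<in> I"
  shows "monomial_partial I f l (e(i := Suc (e i))) x =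
    f i x * monomial_partial I f l e x + (if l = i then monomial I f e x else 0)"
proof (cases "l = i")
  case True
  have "of_nat (e i) * monomial I f e x = of_nat (e i) * (f i x * monomial I f (e(i := e i - 1)) x)"
    using monomial_Suc[OF assms, of f "e(i := e i - 1)" x]
    by (cases "e i") (simp_all add: fun_upd_idem)
  then show ?thesis
    using True by (simp add: monomial_partial_def fun_upd_idem algebra_simps)
next
  case False
  then have "(e(i := Suc (e i)))(l := e l - 1) = (e(l := e l - 1))(i := Suc ((e(l := e l - 1)) i))"
    by (simp add: fun_upd_twist)
  then have "monomial I f ((e(i := Suc (e i)))(l := e l - 1)) x =
      f i x * monomial I f (e(l := e l - 1)) x"
    by (simp only: monomial_Suc[OF assms])
  then show ?thesis
    using False by (simp add: monomial_partial_def mult.left_commute)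
qed

lemma has_gradient_monomial:
  "has_gradient (monomial UNIV coord e :: 'a::comm_ring_1 ^ 'n \<Rightarrow> 'a)
    (\<lambda>x. \<chi> l. monomial_partial UNIV coord l e x)"
proof (induction "sum e UNIV" arbitrary: e)
  case 0
  then have "e = (\<lambda>_. 0)"
    by (simp add: fun_eq_iff)
  then show ?case
    using has_gradient_const[of 1]
    by (simp add: monomial_def[abs_def] monomial_partial_def zero_vec_def)
next
  case (Suc n)
  then obtain i where "e i \<noteq> 0"
    by (metis nat.distinct(1) sum.neutral)
  define e' where "e' = e(i := e i - 1)"
  have e: "e = e'(i := Suc (e' i))"
    using \<open>e i \<noteq> 0\<close> by (simp add: e'_def)
  have "n = sum e' UNIV"
    using Suc.hyps(2) sum_fun_upd[of UNIV i e "e i - 1"] \<open>e i \<noteq> 0\<close> by (simp add: e'_def)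
  then have "has_gradient (\<lambda>x :: 'a ^ 'n. coord i x * monomial UNIV coord e' x)
      (\<lambda>x. coord i x *s (\<chi> l. monomial_partial UNIV coord l e' x) +
        monomial UNIV coord e' x *s axis i 1)"
    by (intro has_gradient_mult has_gradient_coord Suc.hyps(1) coord_polyfun monomial_subalg UNIV_I)
  moreover have "coord i x *s (\<chi> l. monomial_partial UNIV coord l e' x) +
      monomial UNIV coord e' x *s axis i 1 = (\<chi> l. monomial_partial UNIV coord l e x)"
    for x :: "'a ^ 'n"
    by (simp add: e monomial_partial_Suc vec_eq_iff axis_def)
  moreover have "monomial UNIV coord e = (\<lambda>x :: 'a ^ 'n. coord i x * monomial UNIV coord e' x)"
    by (simp add: e monomial_Suc fun_eq_iff)
  ultimately show ?case
    by simp
qed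

definition poly_upto :: "nat \<Rightarrow> (('n::finite \<Rightarrow> nat) \<Rightarrow> 'a::comm_ring_1) \<Rightarrow> 'a ^ 'n \<Rightarrow> 'a" where
  "poly_upto d c y = (\<Sum>e\<in>exponents UNIV d. c e * monomial UNIV coord e y)"

lemma has_gradient_poly_upto:
  fixes c :: "('n::finite \<Rightarrow> nat) \<Rightarrow> 'a::comm_ring_1"
  shows "has_gradient (poly_upto (Suc d) c)
    (\<lambda>y. \<chi> l. poly_upto d (\<lambda>e. of_nat (Suc (e l)) * c (e(l := Suc (e l)))) y)"
proof -
  have "has_gradient (poly_upto (Suc d) c)
      (\<lambda>y. \<Sum>e\<in>exponents UNIV (Suc d). c e *s (\<chi> l. monomial_partial UNIV coord l e y))"
    unfolding poly_upto_def[abs_def]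
    by (intro has_gradient_sum has_gradient_scale has_gradient_monomial)
  moreover have "(\<Sum>e\<in>exponents UNIV (Suc d). c e *s (\<chi> l. monomial_partial UNIV coord l e y)) $ l =
      poly_upto d (\<lambda>e. of_nat (Suc (e l)) * c (e(l := Suc (e l)))) y" for l and y :: "'a ^ 'n"
  proof -
    have UNIV: "insert l (- {l}) = UNIV"
      by auto
    have "(\<Sum>e\<in>exponents (- {l}) (Suc d). c e * monomial_partial UNIV coord l e y) = 0"
      by (intro sum.neutral) (simp add: exponents_def monomial_partial_def)
    then show ?thesis
      using sum_exponents_insert[of "- {l}" l "\<lambda>e. c e * monomial_partial UNIV coord l e y" d]
      by (simp add: UNIV poly_upto_def monomial_partial_def mult_ac fun_upd_idem)
  qed
  then have "(\<lambda>y :: 'a ^ 'n.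
      \<Sum>e\<in>exponents UNIV (Suc d). c e *s (\<chi> l. monomial_partial UNIV coord l e y)) =
      (\<lambda>y. \<chi> l. poly_upto d (\<lambda>e. of_nat (Suc (e l)) * c (e(l := Suc (e l)))) y)"
    by (simp only: fun_eq_iff vec_eq_iff vec_lambda_beta) blast
  ultimately show ?thesis
    by (simp only:)
qed

lemma poly_upto_CHAR_power:
  fixes c :: "('n::finite \<Rightarrow> nat) \<Rightarrow> 'a::alg_closed_field"
  assumes p: "p = CHAR('a)" "p > 0" and dvd: "\<And>e l. e \<in> exponents UNIV d \<Longrightarrow> c e \<noteq> 0 \<Longrightarrow> p dvd e l"
  obtains r where "\<And>e. r e ^ p = c (\<lambda>l. p * e l)"
    "\<And>y. poly_upto d c y = poly_upto (d div p) r y ^ p"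
proof -
  have "\<exists>r. \<forall>e. r e ^ p = c (\<lambda>l. p * e l)"
    by (intro choice allI nth_root_exists p(2))
  then obtain r where r: "\<And>e. r e ^ p = c (\<lambda>l. p * e l)"
    by blast
  define E where "E = (exponents UNIV (d div p) :: ('n \<Rightarrow> nat) set)"
  have scale: "(\<lambda>l. p * e l) \<in> exponents UNIV d \<longleftrightarrow> e \<in> E" for e :: "'n \<Rightarrow> nat"
    using p(2)
    by (simp add: E_def exponents_def less_eq_div_iff_mult_less_eq mult.commute
        flip: sum_distrib_left)
  have inj: "inj_on (\<lambda>e l. p * e l) E"
    using p(2) by (auto simp: inj_on_def fun_eq_iff)
  have "c e = 0" if e: "e \<in> exponents UNIV d" "e \<notin> (\<lambda>e l. p * e l) ` E" for e
  proof (rule ccontr)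
    assume "c e \<noteq> 0"
    then have "e = (\<lambda>l. p * (e l div p))"
      using dvd[OF e(1)] by (simp add: fun_eq_iff)
    then show False
      using e scale[of "\<lambda>l. e l div p"] by auto
  qed
  then have "poly_upto d c y = (\<Sum>e\<in>(\<lambda>e l. p * e l) ` E. c e * monomial UNIV coord e y)" for y
    unfolding poly_upto_def using scale
    by (intro sum.mono_neutral_right) (auto simp: finite_exponents)
  also have "(\<Sum>e\<in>(\<lambda>e l. p * e l) ` E. c e * monomial UNIV coord e y) =
      (\<Sum>e\<in>E. (r e * monomial UNIV coord e y) ^ p)" for y
    unfolding sum.reindex[OF inj]
    by (intro sum.cong refl)
      (simp add: r power_mult_distrib monomial_def prod_power_distrib mult.commute flip: power_mult)
  also have "(\<Sum>e\<in>E. (r e * monomial UNIV coord e y) ^ p) = poly_upto (d div p) r y ^ p" for y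
    unfolding poly_upto_def E_def
    by (rule freshmans_dream_sum[OF prime_CHAR_semidom, symmetric]) (use p in auto)
  finally show ?thesis
    using that r by blast
qed

definition relation_upto ::
    "('a::comm_ring_1 ^ 'n) set \<Rightarrow> nat \<Rightarrow> (('n::finite \<Rightarrow> nat) \<Rightarrow> 'a) \<Rightarrow> bool" where
  "relation_upto Y d c \<longleftrightarrow> (\<exists>e\<in>exponents UNIV d. c e \<noteq> 0) \<and> vanishes_on (poly_upto d c) Y"

lemma ex_relation_upto:
  assumes "f \<in> polyfun UNIV" "vanishes_on f Y" "f y \<noteq> 0"
  shows "\<exists>d c. relation_upto Y d c"
proof -
  obtain d c where f: "f = poly_upto d c"
    using subalg_imp_degree_le[of UNIV f coord] assms(1)
    by (auto elim!: degree_leE simp: poly_upto_def[abs_def])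
  then obtain e where "e \<in> exponents UNIV d" "c e * monomial UNIV coord e y \<noteq> 0"
    using assms(3) unfolding poly_upto_def by (meson sum.not_neutral_contains_not_neutral)
  then have "relation_upto Y d c"
    using assms(2) f by (auto simp: relation_upto_def dest: mult_not_zero)
  then show ?thesis
    by blast
qed

lemma relation_upto_nonconstant:
  assumes "relation_upto Y d c" "Y \<noteq> {}"
  shows "\<exists>e\<in>exponents UNIV d. c e \<noteq> 0 \<and> e \<noteq> (\<lambda>_. 0)"
proof (rule ccontr)
  assume const: "\<not> ?thesis"
  then have "poly_upto d c y = (\<Sum>e\<in>{\<lambda>_. 0}. c e * monomial UNIV coord e y)" for y
    unfolding poly_upto_def
    by (intro sum.mono_neutral_right) (auto simp: finite_exponents, simp add: exponents_def)
  then show False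
    using assms const by (auto simp: relation_upto_def)
qed

lemma CHAR_dvd_exponent:
  fixes c :: "('n::finite \<Rightarrow> nat) \<Rightarrow> 'a::idom"
  assumes "\<And>e. e \<in> exponents UNIV d \<Longrightarrow> of_nat (Suc (e l)) * c (e(l := Suc (e l))) = 0"
    and "e \<in> exponents UNIV (Suc d)" "c e \<noteq> 0"
  shows "CHAR('a) dvd e l"
proof (cases "e l")
  case (Suc i)
  have "e(l := i) \<in> exponents UNIV d"
    using upd_pred_in_exponents[OF finite UNIV_I assms(2), of l] Suc by simp
  from assms(1)[OF this] have "of_nat (e l) * c e = 0"
    using Suc by (simp add: fun_upd_idem del: of_nat_Suc)
  then show ?thesis
    using assms(3) by (simp add: of_nat_eq_0_iff_char_dvd)
qed simp

lemma relation_upto_CHAR_root: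
  fixes c :: "('n::finite \<Rightarrow> nat) \<Rightarrow> 'a::alg_closed_field"
  assumes "relation_upto Y d c" "Y \<noteq> {}"
    and dvd: "\<And>e l. e \<in> exponents UNIV d \<Longrightarrow> c e \<noteq> 0 \<Longrightarrow> CHAR('a) dvd e l"
  shows "\<exists>d' r. d' < d \<and> relation_upto Y d' r"
proof -
  define p where "p = CHAR('a)"
  obtain e where e: "e \<in> exponents UNIV d" "c e \<noteq> 0" "e \<noteq> (\<lambda>_. 0)"
    using relation_upto_nonconstant[OF assms(1,2)] by blast
  then have "p > 0"
    using dvd[OF e(1,2)] by (auto simp: p_def fun_eq_iff intro: gr0I)
  then obtain r where r: "\<And>e. r e ^ p = c (\<lambda>l. p * e l)"
    "\<And>y. poly_upto d c y = poly_upto (d div p) r y ^ p"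
    using poly_upto_CHAR_power[of p d c] dvd p_def by metis
  define e' where "e' l = e l div p" for l
  have e': "e = (\<lambda>l. p * e' l)"
    using dvd[OF e(1,2)] by (simp add: e'_def p_def fun_eq_iff)
  have "r e' \<noteq> 0"
    using r(1)[of e'] e(2) \<open>p > 0\<close> by (auto simp: zero_power simp flip: e')
  moreover have "e' \<in> exponents UNIV (d div p)"
    using e(1) \<open>p > 0\<close> unfolding e'
    by (simp add: exponents_def less_eq_div_iff_mult_less_eq mult.commute flip: sum_distrib_left)
  ultimately have "relation_upto Y (d div p) r"
    using assms(1) r(2) \<open>p > 0\<close> unfolding relation_upto_def by auto
  moreover have "d > 0"
    using e(1,3) by (auto intro!: gr0I)
  then have "d div p < d"
    using prime_gt_1_nat[OF prime_CHAR_semidom[where ?'a = 'a]] \<open>p > 0\<close> by (simp add: p_def)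
  ultimately show ?thesis
    by blast
qed

text \<open>
  A relation of minimal degree has a partial derivative that does not vanish on \<open>Y\<close>: otherwise all
  its derivatives are zero by minimality, so that it is a constant or a \<open>p\<close>-th power.
\<close>

lemma separable_relation:
  fixes Y :: "('a::alg_closed_field ^ 'm) set"
  assumes "Y \<noteq> {}" "f \<in> polyfun UNIV" "vanishes_on f Y" "f z \<noteq> 0"
  obtains G G' where "has_gradient G G'" "vanishes_on G Y" "\<not> vanishes_on G' Y"
proof -
  have ex: "\<exists>d c. relation_upto Y d c"
    using ex_relation_upto[OF assms(2-4)] .
  define d where "d = (LEAST d. \<exists>c. relation_upto Y d c)"
  obtain c where c: "relation_upto Y d c"
    using LeastI_ex[OF ex] unfolding d_def by blast
  have minimal: "\<not> relation_upto Y d' c'" if "d' < d" for d' c'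
    using not_less_Least[of d' "\<lambda>d. \<exists>c. relation_upto Y d c"] that unfolding d_def by blast
  obtain k where d: "d = Suc k"
    using relation_upto_nonconstant[OF c assms(1)] by (cases d) auto
  define c' where "c' l e = of_nat (Suc (e l)) * c (e(l := Suc (e l)))" for l e
  have "\<not> vanishes_on (\<lambda>y. \<chi> l. poly_upto k (c' l) y) Y"
  proof
    assume "vanishes_on (\<lambda>y. \<chi> l. poly_upto k (c' l) y) Y"
    then have "vanishes_on (poly_upto k (c' l)) Y" for l
      by (auto simp: vec_eq_iff)
    then have "c' l e = 0" if "e \<in> exponents UNIV k" for l e
      using minimal[of k "c' l"] that by (auto simp: relation_upto_def d)
    then have "CHAR('a) dvd e l" if "e \<in> exponents UNIV d" "c e \<noteq> 0" for e l
      using CHAR_dvd_exponent[of k l c e] that unfolding c'_def d by blast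
    then show False
      using relation_upto_CHAR_root[OF c assms(1)] minimal by blast
  qed
  then show ?thesis
    using that[OF has_gradient_poly_upto[of k c, folded c'_def]] c
    by (simp add: relation_upto_def d)
qed

section \<open>Tangent spaces\<close>

definition gradients :: "('a::field ^ 'n) set \<Rightarrow> 'a ^ 'n \<Rightarrow> ('a ^ 'n) set" where
  "gradients V a = {f' a | f f'. has_gradient f f' \<and> vanishes_on f V}"

definition annihilator :: "('a::field ^ 'n) set \<Rightarrow> ('a ^ 'n) set" where
  "annihilator S = {w. \<forall>v\<in>S. dot v w = 0}"

definition tangent_space :: "('a::field ^ 'n) set \<Rightarrow> 'a ^ 'n \<Rightarrow> ('a ^ 'n) set" where
  "tangent_space V a = annihilator (gradients V a)"

lemma subspace_annihilator: "vec.subspace (annihilator S)"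
  by (auto simp: vec.subspace_def annihilator_def dot_add_right dot_scale_right)

lemma annihilator_span: "annihilator (vec.span S) = annihilator S"
proof -
  have "vec.span S \<subseteq> {v. dot v w = 0}" if "w \<in> annihilator S" for w
    using that by (intro vec.span_minimal)
      (auto simp: annihilator_def vec.subspace_def dot_add_left dot_scale_left)
  then show ?thesis
    using vec.span_superset[of S] unfolding annihilator_def by blast
qed

lemma dim_annihilator_insert:
  "vec.dim (annihilator S) \<le> vec.dim (annihilator (insert v S)) + 1"
proof (cases "\<exists>w\<in>annihilator S. dot v w \<noteq> 0")
  case True
  then obtain u where u: "u \<in> annihilator S" "dot v u \<noteq> 0"
    by blast
  have "w \<in> vec.span (insert u (annihilator (insert v S)))" if "w \<in> annihilator S" for w
  proof -
    define c where "c = dot v w / dot v u"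
    have "w - c *s u \<in> annihilator (insert v S)"
      using that u by (simp add: annihilator_def c_def dot_diff_right dot_scale_right)
    then have "(w - c *s u) + c *s u \<in> vec.span (insert u (annihilator (insert v S)))"
      by (intro vec.span_add vec.span_scale) (auto intro: vec.span_base)
    then show ?thesis
      by simp
  qed
  then have "vec.dim (annihilator S) \<le> vec.dim (vec.span (insert u (annihilator (insert v S))))"
    by (intro vec.dim_subset) blast
  also have "\<dots> \<le> vec.dim (annihilator (insert v S)) + 1"
    unfolding vec.dim_span by (simp add: vec.dim_insert)
  finally show ?thesis .
next
  case False
  then have "annihilator (insert v S) = annihilator S"
    by (auto simp: annihilator_def)
  then show ?thesis
    by simp
qed

lemma CARD_le_dim_annihilator:
  fixes S :: "('a::field ^ 'n) set"
  shows "CARD('n) \<le> vec.dim (annihilator S) + vec.dim S"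
proof -
  obtain B where B: "B \<subseteq> S" "vec.independent B" "S \<subseteq> vec.span B" "card B = vec.dim S"
    using vec.basis_exists by blast
  have "finite B"
    using B(2) by (rule vec.finiteI_independent)
  then have "CARD('n) \<le> vec.dim (annihilator B) + card B"
  proof (induction B rule: finite_induct)
    case empty
    then show ?case
      by (simp add: annihilator_def card_cart_basis)
  next
    case (insert v B)
    then show ?case
      using dim_annihilator_insert[of B v] by simp
  qed
  moreover have "annihilator B = annihilator S"
    using annihilator_span[of B] annihilator_span[of S] B(1,3)
    by (metis vec.span_mono vec.span_span subset_antisym)
  ultimately show ?thesis
    using B(4) by simp
qed

lemma spanning_with_axes:
  fixes U :: "('a::field ^ 'n) set"
  obtains Z where "vec.span (U \<union> (\<lambda>z. axis z 1) ` Z) = UNIV" "card Z + vec.dim U \<le> CARD('n)"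
proof -
  obtain S where S: "S \<subseteq> U" "vec.independent S" "U \<subseteq> vec.span S" "card S = vec.dim U"
    using vec.basis_exists by blast
  obtain B where B: "S \<subseteq> B" "B \<subseteq> S \<union> cart_basis" "vec.independent B" "S \<union> cart_basis \<subseteq> vec.span B"
    using vec.maximal_independent_subset_extend[of S "S \<union> cart_basis"] S(2) by blast
  define Z where "Z = {z. axis z 1 \<in> B - S}"
  have image: "B - S = (\<lambda>z. axis z 1) ` Z"
    using B(2) by (auto simp: Z_def cart_basis_def)
  have "B \<subseteq> U \<union> (\<lambda>z. axis z 1) ` Z"
    using S(1) image by auto
  moreover have "vec.span B = UNIV"
    using B(4) vec.span_minimal[OF _ vec.subspace_span, of cart_basis B] by auto
  ultimately have "vec.span (U \<union> (\<lambda>z. axis z 1) ` Z) = UNIV"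
    using vec.span_mono by blast
  moreover have "card Z + vec.dim U \<le> CARD('n)"
  proof -
    have "finite B"
      using B(3) by (rule vec.finiteI_independent)
    have "card Z = card (B - S)"
      unfolding image by (rule card_image[symmetric]) (auto simp: inj_on_def axis_eq_axis)
    also have "\<dots> + card S = card B"
      using \<open>finite B\<close> B(1) by (simp add: card_Diff_subset finite_subset card_mono)
    also have "\<dots> \<le> CARD('n)"
      using vec.independent_card_le_dim[OF subset_UNIV B(3)] by (simp add: card_cart_basis)
    finally show ?thesis
      using S(4) by simp
  qed
  ultimately show ?thesis
    by (rule that)
qed

lemma basis_matrix:
  fixes S :: "('a::field ^ 'n) set"
  assumes "vec.span S = UNIV"
  obtains A :: "'a ^ 'n ^ 'n" where "\<And>j. A $ j \<in> S" "det A \<noteq> 0"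
proof -
  obtain B where B: "B \<subseteq> S" "vec.independent B" "S \<subseteq> vec.span B" "card B = vec.dim S"
    using vec.basis_exists by blast
  have "vec.span B = UNIV"
    using vec.span_minimal[OF B(3) vec.subspace_span] assms by auto
  moreover have "card B = CARD('n)"
    using B(4) vec.dim_span[of S] assms by (simp add: card_cart_basis)
  then obtain \<sigma> where \<sigma>: "bij_betw \<sigma> (UNIV :: 'n set) B"
    using finite_same_card_bij[of "UNIV :: 'n set" B] vec.finiteI_independent[OF B(2)] by auto
  define A where "A = (\<chi> j. \<sigma> j)"
  have "rows A = B"
    using \<sigma> by (auto simp: rows_def row_def A_def bij_betw_def)
  ultimately have "\<exists>A'. A' ** A = mat 1"
    using matrix_left_invertible_span_rows_gen[of A] by simp
  then have "det A \<noteq> 0"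
    using invertible_left_inverse[of A] invertible_det_nz[of A] by simp
  moreover have "A $ j \<in> S" for j
    using \<sigma> B(1) by (auto simp: A_def bij_betw_def)
  ultimately show ?thesis
    by (rule that[rotated])
qed

definition cofactor :: "'a::field ^ 'n ^ 'n \<Rightarrow> 'n \<Rightarrow> 'n \<Rightarrow> 'a" where
  "cofactor A k i = det (\<chi> l. if l = k then axis i 1 else column l A)"

lemma det_mult_nth: "det A * w $ k = (\<Sum>i\<in>UNIV. (A *v w) $ i * cofactor A k i)"
proof -
  have "det A * w $ k =
      det (\<chi> l. if l = k then \<Sum>i\<in>UNIV. w $ i *s column i A else column l A)"
    using cramer_lemma_transpose[of k w "transpose A"]
    by (simp only: row_transpose det_transpose mult.commute)
  also have "(\<Sum>i\<in>UNIV. w $ i *s column i A) = (\<Sum>i\<in>UNIV. (A *v w) $ i *s axis i 1)"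
    by (simp add: matrix_mult_sum[symmetric] basis_expansion)
  also have "det (\<chi> l. if l = k then \<Sum>i\<in>UNIV. (A *v w) $ i *s axis i 1 else column l A) =
      (\<Sum>i\<in>UNIV. (A *v w) $ i * cofactor A k i)"
    by (simp add: det_linear_row_sum[OF finite] det_row_mul cofactor_def)
  finally show ?thesis .
qed

lemma cofactor_subalg:
  assumes "\<And>i j. (\<lambda>x. M x $ i $ j) \<in> subalg X"
  shows "(\<lambda>x. cofactor (M x) k i) \<in> subalg X"
  unfolding cofactor_def
proof (rule subalg_det)
  show "(\<lambda>x. (\<chi> l. if l = k then axis i 1 else column l (M x)) $ l $ j) \<in> subalg X" for l j
    using assms[of j l] by (cases "l = k") (simp_all add: column_def subalg.const)
qed

lemma (in domain_extension) diagonal_idealI: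
  assumes "finite J" "\<And>j. j \<in> J \<Longrightarrow> \<alpha> j \<in> subalg X"
    and "\<And>x y. x \<in> V \<Longrightarrow> y \<in> V \<Longrightarrow> W x y = (\<Sum>j\<in>J. p j x * (\<alpha> j x - \<alpha> j y) * r j y)"
  shows "W \<in> diagonal_ideal"
proof -
  obtain h where h: "bij_betw h {..<card J} J"
    using ex_bij_betw_nat_finite[OF assms(1)] by (auto simp: atLeast0LessThan)
  have "\<forall>i<card J. \<alpha> (h i) \<in> subalg X"
    using assms(2) h by (auto simp: bij_betw_def)
  moreover have "W x y = (\<Sum>i<card J. p (h i) x * (\<alpha> (h i) x - \<alpha> (h i) y) * r (h i) y)"
    if "x \<in> V" "y \<in> V" for x y
    using assms(3)[OF that] sum.reindex_bij_betw[OF h, of "\<lambda>j. p j x * (\<alpha> j x - \<alpha> j y) * r j y"]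
    by simp
  ultimately show ?thesis
    unfolding diagonal_ideal_def
    by (intro CollectI exI[of _ "card J"] exI[of _ "\<lambda>i. p (h i)"] exI[of _ "\<lambda>i. \<alpha> (h i)"]
        exI[of _ "\<lambda>i. r (h i)"]) simp
qed

lemma domain_extension_polyfun:
  "integral_on V (polyfun UNIV) \<Longrightarrow> domain_extension V (coord ` Z) (coord ` UNIV)"
  by unfold_locales (auto intro: coord_polyfun)

lemma bipolyfun_sum_diagonal_ideal:
  fixes V :: "('a::field ^ 'n) set"
  assumes V: "integral_on V (polyfun UNIV)"
    and \<alpha>: "\<And>i::'n. \<alpha> i \<in> polyfun Z" and Q: "\<And>i. Q i \<in> bipolyfun"
    and W: "\<And>x y. x \<in> V \<Longrightarrow> y \<in> V \<Longrightarrow> W x y = (\<Sum>i\<in>UNIV. (\<alpha> i x - \<alpha> i y) * Q i (x, y))"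
  shows "W \<in> domain_extension.diagonal_ideal V (coord ` Z)"
proof -
  interpret domain_extension V "coord ` Z" "coord ` UNIV"
    using V by (rule domain_extension_polyfun)
  have "\<forall>i. \<exists>L. tensor_expansion (Q i) L"
    using bipolyfun_tensor_expansion[OF Q] ..
  from choice[OF this] obtain L where "\<forall>i. tensor_expansion (Q i) (L i)" ..
  then have L: "Q i (x, y) = (\<Sum>q\<leftarrow>L i. fst q x * snd q y)" for i x y
    by (simp add: tensor_expansion_def)
  define I where "I = Sigma UNIV (\<lambda>i. {..<length (L i)})"
  show ?thesis
  proof (rule diagonal_idealI)
    show "finite I" "\<alpha> (fst q) \<in> polyfun Z" for q
      using \<alpha> by (simp_all add: I_def)
    fix x y
    assume "x \<in> V" "y \<in> V"
    then have "W x y = (\<Sum>i\<in>UNIV. \<Sum>m<length (L i).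
        fst (L i ! m) x * (\<alpha> i x - \<alpha> i y) * snd (L i ! m) y)"
      by (simp add: W L sum_list_sum_nth atLeast0LessThan sum_distrib_left mult_ac)
    also have "\<dots> = (\<Sum>q\<in>I. fst (L (fst q) ! snd q) x * (\<alpha> (fst q) x - \<alpha> (fst q) y) *
        snd (L (fst q) ! snd q) y)"
      by (simp add: I_def sum.Sigma case_prod_beta)
    finally show "W x y = \<dots>" .
  qed
qed

definition base_quotient ::
    "('a::field ^ 'n) set \<Rightarrow> 'n set \<Rightarrow> (('a ^ 'n) \<times> ('a ^ 'n) \<Rightarrow> 'a ^ 'n) \<Rightarrow>
      ('a ^ 'n \<Rightarrow> 'a) \<Rightarrow> bool" where
  "base_quotient V Z D \<alpha> \<longleftrightarrow> (\<forall>j. (\<lambda>p. D p $ j) \<in> bipolyfun) \<and> \<alpha> \<in> polyfun Z \<and>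
     (\<forall>x\<in>V. \<forall>y\<in>V. dot (D (x, y)) (x - y) = \<alpha> x - \<alpha> y)"

lemma ex_base_quotient:
  assumes "v \<in> gradients V a \<union> (\<lambda>z. axis z 1) ` Z"
  shows "\<exists>D \<alpha>. base_quotient V Z D \<alpha> \<and> D (a, a) = v"
  using assms
proof
  assume "v \<in> gradients V a"
  then obtain f D where "vanishes_on f V" "difference_quotient f D" "v = D (a, a)"
    unfolding gradients_def has_gradient_def by blast
  moreover have "dot (D (x, y)) (x - y) = f x - f y" for x y
    using \<open>difference_quotient f D\<close> by (simp add: difference_quotient_def)
  ultimately have "base_quotient V Z D (\<lambda>_. 0)" "D (a, a) = v"
    by (auto simp: base_quotient_def difference_quotient_def)
  then show ?thesis
    by blast
next
  assume "v \<in> (\<lambda>z. axis z 1) ` Z"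
  then obtain z where "z \<in> Z" "v = axis z 1"
    by blast
  then have "base_quotient V Z (\<lambda>_. v) (coord z)"
    by (auto simp: base_quotient_def coord_polyfun coord_def)
  then show ?thesis
    by blast
qed

definition base_quotient_matrix ::
    "('a::field ^ 'n) set \<Rightarrow> 'n set \<Rightarrow> (('a ^ 'n) \<times> ('a ^ 'n) \<Rightarrow> 'a ^ 'n ^ 'n) \<Rightarrow> bool" where
  "base_quotient_matrix V Z J \<longleftrightarrow> (\<forall>i. \<exists>\<alpha>. base_quotient V Z (\<lambda>p. J p $ i) \<alpha>)"

lemma base_quotient_matrix_bipolyfun:
  "base_quotient_matrix V Z J \<Longrightarrow> (\<lambda>p. J p $ i $ j) \<in> bipolyfun"
  by (auto simp: base_quotient_matrix_def base_quotient_def)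

lemma ex_base_quotient_matrix:
  fixes V :: "('a::field ^ 'n) set"
  assumes "vec.span (gradients V a \<union> (\<lambda>z. axis z 1) ` Z) = UNIV"
  obtains J where "base_quotient_matrix V Z J" "det (J (a, a)) \<noteq> 0"
proof -
  obtain A :: "'a ^ 'n ^ 'n"
    where A: "\<And>i. A $ i \<in> gradients V a \<union> (\<lambda>z. axis z 1) ` Z" "det A \<noteq> 0"
    by (rule basis_matrix[OF assms]) (rule that)
  have "\<forall>i. \<exists>D. (\<exists>\<alpha>. base_quotient V Z D \<alpha>) \<and> D (a, a) = A $ i"
    using ex_base_quotient[OF A(1)] by blast
  from choice[OF this] obtain D
    where D: "\<forall>i. (\<exists>\<alpha>. base_quotient V Z (D i) \<alpha>) \<and> D i (a, a) = A $ i" ..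
  show ?thesis
  proof (rule that[of "\<lambda>p. \<chi> i. D i p"])
    show "base_quotient_matrix V Z (\<lambda>p. \<chi> i. D i p)"
      using D by (simp add: base_quotient_matrix_def)
    show "det (\<chi> i. D i (a, a)) \<noteq> 0"
      using D A(2) by simp
  qed
qed

text \<open>
  By Cramer's rule, \<open>u = det J\<close> satisfies \<open>u(x,y) (x\<^sub>k - y\<^sub>k) = \<Sum>\<^sub>i (\<alpha>\<^sub>i(x) - \<alpha>\<^sub>i(y)) C\<^sub>k\<^sub>i(x,y)\<close> on
  \<open>V \<times> V\<close>, where \<open>C\<^sub>k\<^sub>i\<close> are the cofactors of \<open>J\<close>.
\<close>

lemma det_mult_diff_in_diagonal_ideal:
  fixes V :: "('a::field ^ 'n) set"
  assumes V: "integral_on V (polyfun UNIV)" and J: "base_quotient_matrix V Z J"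
    and g: "g \<in> polyfun UNIV"
  shows "(\<lambda>x y. det (J (x, y)) * (g x - g y)) \<in> domain_extension.diagonal_ideal V (coord ` Z)"
proof -
  obtain \<alpha> where \<alpha>: "\<And>i. base_quotient V Z (\<lambda>p. J p $ i) (\<alpha> i)"
    using choice[OF J[unfolded base_quotient_matrix_def]] by blast
  obtain E where E: "difference_quotient g E"
    using polyfun_imp_has_gradient[OF g] by (auto elim: has_gradientE)
  define Q where "Q i p = (\<Sum>k\<in>UNIV. E p $ k * cofactor (J p) k i)" for i p
  show ?thesis
  proof (rule bipolyfun_sum_diagonal_ideal[OF V])
    show "\<alpha> i \<in> polyfun Z" for i
      using \<alpha> by (simp add: base_quotient_def)
    show "Q i \<in> bipolyfun" for i
      unfolding Q_def using E
      by (intro subalg_sum subalg.mult cofactor_subalg base_quotient_matrix_bipolyfun[OF J])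
        (simp add: difference_quotient_def)
    fix x y
    assume "x \<in> V" "y \<in> V"
    then have J_diff: "(J (x, y) *v (x - y)) $ i = \<alpha> i x - \<alpha> i y" for i
      using \<alpha>[of i] by (simp add: base_quotient_def matrix_vector_mult_nth)
    have "det (J (x, y)) * (g x - g y) = (\<Sum>k\<in>UNIV. E (x, y) $ k * (det (J (x, y)) * (x - y) $ k))"
      using E by (simp add: difference_quotient_def dot_def sum_distrib_left mult.left_commute)
    also have "\<dots> = (\<Sum>k\<in>UNIV. \<Sum>i\<in>UNIV.
        (\<alpha> i x - \<alpha> i y) * (E (x, y) $ k * cofactor (J (x, y)) k i))"
      unfolding det_mult_nth by (simp add: J_diff sum_distrib_left mult.left_commute)
    also have "\<dots> = (\<Sum>i\<in>UNIV. (\<alpha> i x - \<alpha> i y) * Q i (x, y))"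
      unfolding Q_def sum_distrib_left by (rule sum.swap)
    finally show "det (J (x, y)) * (g x - g y) = \<dots>" .
  qed
qed

lemma jacobian_criterion:
  fixes V :: "('a::field ^ 'n) set"
  assumes V: "integral_on V (polyfun UNIV)" and a: "a \<in> V"
    and span: "vec.span (gradients V a \<union> (\<lambda>z. axis z 1) ` Z) = UNIV"
  obtains N where "\<And>T. finite T \<Longrightarrow> T \<subseteq> polyfun UNIV \<Longrightarrow>
    domain_extension.lin_indep V (coord ` Z) T \<Longrightarrow> card T \<le> N"
proof -
  interpret domain_extension V "coord ` Z" "coord ` UNIV"
    using V by (rule domain_extension_polyfun)
  obtain J where J: "base_quotient_matrix V Z J" "det (J (a, a)) \<noteq> 0"
    by (rule ex_base_quotient_matrix[OF span])
  obtain N :: nat and b c where b: "\<And>i. i < N \<Longrightarrow> b i \<in> polyfun UNIV"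
    and c: "\<And>i. i < N \<Longrightarrow> c i \<in> polyfun UNIV"
    and det: "\<And>x y. det (J (x, y)) = (\<Sum>i<N. b i x * c i y)"
    by (rule bipolyfun_expansion[OF subalg_det[OF base_quotient_matrix_bipolyfun[OF J(1)]]])
      (rule that)
  have "\<not> vanishes_on (\<lambda>x. \<Sum>i<N. b i x * c i x) V"
    using J(2) a by (auto simp flip: det)
  note bound =
    card_lin_indep_le[OF b c this det_mult_diff_in_diagonal_ideal[OF V J(1), unfolded det]]
  show ?thesis
    by (rule that[of N]) (rule bound)
qed

definition irreducible_chain :: "nat \<Rightarrow> (nat \<Rightarrow> ('a::field ^ 'n) set) \<Rightarrow> bool" where
  "irreducible_chain d C \<longleftrightarrow> (\<forall>i\<le>d. zariski_irreducible (C i)) \<and> (\<forall>i<d. C i \<subset> C (Suc i))"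

lemma irreducible_chain_integral_on: "irreducible_chain d C \<Longrightarrow> integral_on (C d) (polyfun UNIV)"
  by (simp add: irreducible_chain_def zariski_irreducible_iff)

lemma irreducible_chain_alg_indep:
  assumes "irreducible_chain d C"
  shows "\<exists>f. (\<forall>i<d. f i \<in> polyfun UNIV) \<and> alg_indep (C d) {..<d} f"
  using assms
proof (induction d)
  case 0
  then have "C 0 \<noteq> {}"
    by (simp add: irreducible_chain_def zariski_irreducible_def)
  then show ?case
    by (auto simp: alg_indep_def)
next
  case (Suc d)
  then obtain f where f: "\<And>i. i < d \<Longrightarrow> f i \<in> polyfun UNIV" "alg_indep (C d) {..<d} f"
    unfolding irreducible_chain_def by auto
  have C: "zariski_closed (C d)" "integral_on (C (Suc d)) (polyfun UNIV)" "C d \<subset> C (Suc d)"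
    using Suc.prems by (auto simp: irreducible_chain_def zariski_irreducible_iff)
  then obtain y where y: "y \<in> C (Suc d)" "y \<notin> C d"
    by blast
  obtain g where g: "g \<in> polyfun UNIV" "vanishes_on g (C d)" "g y \<noteq> 0"
    using zariski_closed_separation[OF C(1) y(2)] .
  have "alg_indep (C d) {..<d} (f(d := g))"
    using f(2) by (subst alg_indep_cong[of _ _ f]) auto
  then have "alg_indep (C (Suc d)) {..<Suc d} (f(d := g))"
    unfolding lessThan_Suc
    by (rule alg_indep_insert[OF _ _ _ _ C(2), rotated 2]) (use C(3) f(1) g y in auto)
  moreover have "\<forall>i<Suc d. (f(d := g)) i \<in> polyfun UNIV"
    using f(1) g(1) by (simp add: less_Suc_eq)
  ultimately show ?case
    by blast
qed

lemma irreducible_chain_le_dim_tangent_space: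
  fixes C :: "nat \<Rightarrow> ('a::field ^ 'n) set"
  assumes chain: "irreducible_chain k C" and a: "a \<in> C k"
  shows "k \<le> vec.dim (tangent_space (C k) a)"
proof -
  have V: "integral_on (C k) (polyfun UNIV)"
    using chain by (rule irreducible_chain_integral_on)
  obtain Z where Z: "vec.span (gradients (C k) a \<union> (\<lambda>z. axis z 1) ` Z) = UNIV"
    "card Z + vec.dim (gradients (C k) a) \<le> CARD('n)"
    by (rule spanning_with_axes)
  obtain N where N: "\<And>T. finite T \<Longrightarrow> T \<subseteq> polyfun UNIV \<Longrightarrow>
    domain_extension.lin_indep (C k) (coord ` Z) T \<Longrightarrow> card T \<le> N"
    by (rule jacobian_criterion[OF V a Z(1)]) (rule that)
  obtain f where f: "\<And>i. i < k \<Longrightarrow> f i \<in> polyfun UNIV" "alg_indep (C k) {..<k} f"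
    using irreducible_chain_alg_indep[OF chain] by auto
  interpret domain_extension "C k" "coord ` Z" "coord ` UNIV"
    using V by (rule domain_extension_polyfun)
  have "k \<le> card (coord ` Z :: ('a ^ 'n \<Rightarrow> 'a) set)"
    using card_alg_indep_le[OF _ N _ _ f(2)] f(1) by simp
  also have "\<dots> \<le> card Z"
    by (rule card_image_le) simp
  also have "\<dots> \<le> vec.dim (tangent_space (C k) a)"
    using Z(2) CARD_le_dim_annihilator[of "gradients (C k) a"] by (simp add: tangent_space_def)
  finally show ?thesis .
qed

section \<open>Dimension\<close>

lemma irreducible_chain_le_CARD:
  fixes C :: "nat \<Rightarrow> ('a::field ^ 'n) set"
  assumes "irreducible_chain k C"
  shows "k \<le> CARD('n)"
proof -
  obtain a where "a \<in> C k"
    using irreducible_chain_integral_on[OF assms] by (auto simp: integral_on_def)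
  then have "k \<le> vec.dim (tangent_space (C k) a)"
    by (rule irreducible_chain_le_dim_tangent_space[OF assms])
  also have "\<dots> \<le> CARD('n)"
    by (rule dim_subset_UNIV_cart_gen)
  finally show ?thesis .
qed

lemma zariski_dim_eq_Sup_chain:
  "zariski_dim V = Sup {ereal (real d) | d. \<exists>C. irreducible_chain d C \<and> (\<forall>i\<le>d. C i \<subseteq> V)}"
proof -
  have "(\<forall>i\<le>d. zariski_irreducible (C i) \<and> C i \<subseteq> V) \<and> (\<forall>i<d. C i \<subset> C (Suc i)) \<longleftrightarrow>
      irreducible_chain d C \<and> (\<forall>i\<le>d. C i \<subseteq> V)" for d C
    by (auto simp: irreducible_chain_def)
  then show ?thesis
    unfolding zariski_dim_def by simp
qed

lemma le_zariski_dim_imp_chain: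
  assumes "ereal (real k) \<le> zariski_dim V"
  obtains C where "irreducible_chain k C" "\<And>i. i \<le> k \<Longrightarrow> C i \<subseteq> V"
proof -
  have "ereal (real k - 1 / 2) < ereal (real k)"
    by simp
  then have "ereal (real k - 1 / 2) < zariski_dim V"
    using assms by (rule less_le_trans)
  then obtain d C where C: "ereal (real k - 1 / 2) < ereal (real d)" "irreducible_chain d C"
      "\<And>i. i \<le> d \<Longrightarrow> C i \<subseteq> V"
    unfolding zariski_dim_eq_Sup_chain less_Sup_iff by blast
  then have "k \<le> d"
    by simp
  then show ?thesis
    using that[of C] C by (auto simp: irreducible_chain_def)
qed

lemma zariski_irreducible_coordinate_subspace:
  "zariski_irreducible {x :: 'a::alg_closed_field ^ 'n. \<forall>j\<in>T. x $ j = 0}"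
  unfolding zariski_irreducible_iff
proof
  show "zariski_closed {x :: 'a ^ 'n. \<forall>j\<in>T. x $ j = 0}"
    unfolding zariski_closed_iff
    by (intro exI[of _ "coord ` T"]) (auto simp: coord_def intro: coord_polyfun)
  show "integral_on {x :: 'a ^ 'n. \<forall>j\<in>T. x $ j = 0} (polyfun UNIV)"
    by (rule integral_on_affine[OF infinite_UNIV_alg_closed]) (auto intro: exI[of _ 0])
qed

lemma zariski_dim_UNIV:
  "zariski_dim (UNIV :: ('a::alg_closed_field ^ 'n) set) = ereal (real CARD('n))"
proof (rule antisym)
  show "zariski_dim (UNIV :: ('a ^ 'n) set) \<le> ereal (real CARD('n))"
    unfolding zariski_dim_eq_Sup_chain
    by (rule Sup_least) (auto dest: irreducible_chain_le_CARD)
  obtain idx :: "'n \<Rightarrow> nat" where idx: "bij_betw idx UNIV {..<CARD('n)}"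
    using ex_bij_betw_finite_nat[of "UNIV :: 'n set"] by (auto simp: atLeast0LessThan)
  define C :: "nat \<Rightarrow> ('a ^ 'n) set" where "C i = {x. \<forall>j\<in>{j. i \<le> idx j}. x $ j = 0}" for i
  have "C i \<subset> C (Suc i)" if "i < CARD('n)" for i
  proof
    show "C i \<subseteq> C (Suc i)"
      by (auto simp: C_def)
    obtain j where "idx j = i"
      using idx \<open>i < CARD('n)\<close> by (metis bij_betw_iff_bijections lessThan_iff)
    then have "axis j 1 \<in> C (Suc i)" "axis j 1 \<notin> C i"
      by (auto simp: C_def axis_def)
    then show "C i \<noteq> C (Suc i)"
      by blast
  qed
  then have "irreducible_chain CARD('n) C"
    unfolding irreducible_chain_def C_def
    by (simp only: zariski_irreducible_coordinate_subspace) blast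
  then show "ereal (real CARD('n)) \<le> zariski_dim (UNIV :: ('a ^ 'n) set)"
    unfolding zariski_dim_eq_Sup_chain by (intro Sup_upper) auto
qed

lemma zariski_dim_eq_CARD_iff:
  fixes V :: "('a::alg_closed_field ^ 'n) set"
  shows "zariski_dim V = ereal (real CARD('n)) \<longleftrightarrow> V = UNIV"
proof
  assume "zariski_dim V = ereal (real CARD('n))"
  then obtain C where C: "irreducible_chain CARD('n) C" "\<And>i. i \<le> CARD('n) \<Longrightarrow> C i \<subseteq> V"
    using le_zariski_dim_imp_chain[of "CARD('n)" V] by auto
  show "V = UNIV"
  proof (rule ccontr)
    assume "V \<noteq> UNIV"
    then have "C CARD('n) \<subset> UNIV"
      using C(2)[of "CARD('n)"] by auto
    moreover have "zariski_irreducible (UNIV :: ('a ^ 'n) set)"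
      using zariski_irreducible_coordinate_subspace[of "{}"] by simp
    ultimately have "irreducible_chain (Suc CARD('n)) (C(Suc CARD('n) := UNIV))"
      using C(1) by (auto simp: irreducible_chain_def le_Suc_eq less_Suc_eq)
    then show False
      using irreducible_chain_le_CARD by fastforce
  qed
qed (simp add: zariski_dim_UNIV)

section \<open>Rank extractors\<close>

lemma zariski_closure_eq_UNIV_iff:
  "zariski_closure X = UNIV \<longleftrightarrow> (\<forall>f\<in>polyfun UNIV. vanishes_on f X \<longrightarrow> (\<forall>y. f y = 0))"
proof
  assume dense: "zariski_closure X = UNIV"
  show "\<forall>f\<in>polyfun UNIV. vanishes_on f X \<longrightarrow> (\<forall>y. f y = 0)"
  proof (intro ballI impI)
    fix f
    assume f: "f \<in> polyfun UNIV" "vanishes_on f X"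
    then have "zariski_closure X \<subseteq> {y. f y = 0}"
      unfolding zariski_closure_def using zariski_closed_zeros[OF f(1)] by (intro Inter_lower) auto
    then show "\<forall>y. f y = 0"
      using dense by auto
  qed
next
  assume only_zero: "\<forall>f\<in>polyfun UNIV. vanishes_on f X \<longrightarrow> (\<forall>y. f y = 0)"
  have "U = UNIV" if U: "zariski_closed U" "X \<subseteq> U" for U
  proof (rule ccontr)
    assume "U \<noteq> UNIV"
    then obtain y where "y \<notin> U"
      by blast
    then obtain f where "f \<in> polyfun UNIV" "vanishes_on f U" "f y \<noteq> 0"
      using zariski_closed_separation[OF U(1)] by blast
    then show False
      using only_zero U(2) by blast
  qed
  then show "zariski_closure X = UNIV"
    unfolding zariski_closure_def by blast
qed

lemma rank_failures_iff:
  fixes \<phi> :: "nat \<Rightarrow> 'a::alg_closed_field ^ 'n \<Rightarrow> 'a ^ 'm"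
  shows "i \<in> rank_failures l \<phi> V \<longleftrightarrow>
    i \<in> {1..l} \<and> (\<exists>f\<in>polyfun UNIV. vanishes_on f (\<phi> i ` V) \<and> (\<exists>y. f y \<noteq> 0))"
  by (simp add: rank_failures_def zariski_dim_eq_CARD_iff zariski_closure_eq_UNIV_iff)

lemma rank_failures_antimono:
  fixes \<phi> :: "nat \<Rightarrow> 'a::alg_closed_field ^ 'n \<Rightarrow> 'a ^ 'm"
  assumes "U \<subseteq> V"
  shows "rank_failures l \<phi> V \<subseteq> rank_failures l \<phi> U"
  using assms unfolding rank_failures_iff subset_iff by blast

lemma exponent_le_1_cases:
  fixes e :: "'n::finite \<Rightarrow>\<^sub>0 nat"
  assumes "(\<Sum>j\<in>UNIV. Poly_Mapping.lookup e j) \<le> 1"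
  shows "e = 0 \<or> (\<exists>j. e = Poly_Mapping.single j 1)"
proof (cases "\<exists>j. Poly_Mapping.lookup e j \<noteq> 0")
  case True
  then obtain j where j: "Poly_Mapping.lookup e j \<noteq> 0"
    by blast
  have "Poly_Mapping.lookup e j + (\<Sum>i\<in>UNIV - {j}. Poly_Mapping.lookup e i) \<le> 1"
    using assms by (simp add: sum.remove[of UNIV j])
  then have "Poly_Mapping.lookup e j = 1" "(\<Sum>i\<in>UNIV - {j}. Poly_Mapping.lookup e i) = 0"
    using j by linarith+
  then have "e = Poly_Mapping.single j 1"
    by (intro poly_mapping_eqI) (auto simp: lookup_single when_def)
  then show ?thesis
    by blast
qed (auto intro: poly_mapping_eqI)

lemma linear_mvpoly_eval:
  fixes p :: "('n::finite, 'a::comm_ring_1) mvpoly"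
  assumes "linear_mvpoly p"
  shows "mvpoly_eval p x = Poly_Mapping.lookup p 0 +
    (\<Sum>j\<in>UNIV. Poly_Mapping.lookup p (Poly_Mapping.single j 1) * x $ j)"
proof -
  define unit_exponent where "unit_exponent j = Poly_Mapping.single j (1 :: nat)" for j :: 'n
  have "Poly_Mapping.keys (unit_exponent j) = {j}" for j
    by (simp add: unit_exponent_def)
  then have inj: "inj unit_exponent" and nonzero: "0 \<notin> range unit_exponent"
    by (auto simp: inj_def dest: arg_cong[of _ _ Poly_Mapping.keys])
  have monomial_unit: "monomial UNIV coord (Poly_Mapping.lookup (unit_exponent j)) x = x $ j" for j
    unfolding monomial_def unit_exponent_def
    by (subst prod.remove[of _ j]) (auto simp: lookup_single when_def coord_def)
  have "Poly_Mapping.keys p \<subseteq> insert 0 (range unit_exponent)"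
    using assms exponent_le_1_cases unfolding linear_mvpoly_def unit_exponent_def by blast
  then have "mvpoly_eval p x = (\<Sum>e\<in>insert 0 (range unit_exponent).
      Poly_Mapping.lookup p e * monomial UNIV coord (Poly_Mapping.lookup e) x)"
    by (intro mvpoly_eval_superset) auto
  also have "\<dots> = Poly_Mapping.lookup p 0 * monomial UNIV coord (Poly_Mapping.lookup 0) x +
      (\<Sum>j\<in>UNIV. Poly_Mapping.lookup p (unit_exponent j) *
        monomial UNIV coord (Poly_Mapping.lookup (unit_exponent j)) x)"
    using nonzero by (simp add: sum.reindex[OF inj])
  finally show ?thesis
    by (simp add: monomial_unit zero_poly_mapping.rep_eq) (simp add: unit_exponent_def)
qed

lemma linear_polynomial_map_affine:
  assumes "linear_polynomial_map f"
  shows "\<exists>A b. f = (\<lambda>x. A *v x + b)"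
proof -
  obtain P where P: "\<And>j. linear_mvpoly (P j)" "\<And>x j. f x $ j = mvpoly_eval (P j) x"
    using assms unfolding linear_polynomial_map_def by blast
  have "f x = (\<chi> j t. Poly_Mapping.lookup (P j) (Poly_Mapping.single t 1)) *v x +
      (\<chi> j. Poly_Mapping.lookup (P j) 0)" for x
    by (simp add: vec_eq_iff P(2) linear_mvpoly_eval[OF P(1)] matrix_vector_mult_def add.commute)
  then show ?thesis
    by blast
qed

lemma generic_tangent_image_in_hyperplane:
  fixes A :: "'a::alg_closed_field ^ 'n ^ 'm"
  assumes V: "integral_on V (polyfun UNIV)"
    and f: "f \<in> polyfun UNIV" "vanishes_on f ((\<lambda>x. A *v x + b) ` V)" "f z \<noteq> 0"
  shows "\<exists>g\<in>polyfun UNIV. \<not> vanishes_on g V \<and>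
    (\<forall>a\<in>V. g a \<noteq> 0 \<longrightarrow> (\<exists>\<nu>. \<nu> \<noteq> 0 \<and> (\<forall>w\<in>tangent_space V a. dot \<nu> (A *v w) = 0)))"
proof -
  define \<phi> where "\<phi> x = A *v x + b" for x
  have "\<phi> ` V \<noteq> {}"
    using V by (simp add: integral_on_def)
  then obtain G G' where G: "has_gradient G G'" "vanishes_on G (\<phi> ` V)" "\<not> vanishes_on G' (\<phi> ` V)"
    using separable_relation[of "\<phi> ` V" f z] f unfolding \<phi>_def[abs_def] by blast
  then obtain x l where xl: "x \<in> V" "G' (\<phi> x) $ l \<noteq> 0"
    by (auto simp: vec_eq_iff)
  have "(\<lambda>x. \<phi> x $ j) \<in> polyfun UNIV" for j
    unfolding \<phi>_def by (rule affine_map_polyfun)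
  then have "(\<lambda>x. G' (\<phi> x) $ l) \<in> polyfun UNIV"
    by (intro subalg_comp[OF has_gradient_polyfun[OF G(1), of l]]) (auto simp: coord_def)
  moreover have "dot (G' (\<phi> a)) (A *v w) = 0" if "w \<in> tangent_space V a" for a w
  proof -
    have "G' (\<phi> a) v* A \<in> gradients V a"
      using has_gradient_comp_affine[OF G(1), of A b] G(2) unfolding gradients_def \<phi>_def by auto
    then show ?thesis
      using that by (simp add: tangent_space_def annihilator_def flip: dot_vector_matrix_mult)
  qed
  ultimately show ?thesis
    using xl by (intro bexI[of _ "\<lambda>x. G' (\<phi> x) $ l"]) (auto intro!: exI[of _ "G' (\<phi> _)"])
qed

lemma common_tangent_images_in_hyperplanes:
  fixes A :: "'i \<Rightarrow> 'a::alg_closed_field ^ 'n ^ 'm"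
  assumes V: "integral_on V (polyfun UNIV)" and "finite I"
    and not_dense: "\<And>i. i \<in> I \<Longrightarrow>
      \<exists>f\<in>polyfun UNIV. vanishes_on f ((\<lambda>x. A i *v x + b i) ` V) \<and> (\<exists>y. f y \<noteq> 0)"
  shows "\<exists>a\<in>V. \<forall>i\<in>I. \<exists>\<nu>. \<nu> \<noteq> 0 \<and> (\<forall>w\<in>tangent_space V a. dot \<nu> (A i *v w) = 0)"
proof -
  define in_hyperplane where "in_hyperplane i a \<longleftrightarrow>
    (\<exists>\<nu>. \<nu> \<noteq> 0 \<and> (\<forall>w\<in>tangent_space V a. dot \<nu> (A i *v w) = 0))" for i a
  have "\<forall>i\<in>I. \<exists>g. g \<in> polyfun UNIV \<and> \<not> vanishes_on g V \<and>
      (\<forall>a\<in>V. g a \<noteq> 0 \<longrightarrow> in_hyperplane i a)"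
  proof
    fix i
    assume "i \<in> I"
    from not_dense[OF this] obtain f y where
      "f \<in> polyfun UNIV" "vanishes_on f ((\<lambda>x. A i *v x + b i) ` V)" "f y \<noteq> 0"
      by (elim bexE conjE exE)
    from generic_tangent_image_in_hyperplane[OF V this]
    show "\<exists>g. g \<in> polyfun UNIV \<and> \<not> vanishes_on g V \<and> (\<forall>a\<in>V. g a \<noteq> 0 \<longrightarrow> in_hyperplane i a)"
      unfolding in_hyperplane_def Bex_def .
  qed
  from bchoice[OF this] obtain g where g: "\<forall>i\<in>I. g i \<in> polyfun UNIV \<and> \<not> vanishes_on (g i) V \<and>
    (\<forall>a\<in>V. g i a \<noteq> 0 \<longrightarrow> in_hyperplane i a)" ..
  have "\<not> vanishes_on (\<lambda>x. \<Prod>i\<in>I. g i x) V"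
    by (rule integral_on_prod[OF V]) (use g in blast)+
  then obtain a where "a \<in> V" "(\<Prod>i\<in>I. g i a) \<noteq> 0"
    by blast
  then have "in_hyperplane i a" if "i \<in> I" for i
    using g \<open>finite I\<close> that by simp
  then show ?thesis
    using \<open>a \<in> V\<close> unfolding in_hyperplane_def by blast
qed

lemma image_in_hyperplane_not_dense:
  fixes A :: "'a::field ^ 'n ^ 'm"
  assumes "\<nu> \<noteq> 0" "\<forall>w\<in>W. dot \<nu> (A *v w) = 0"
  shows "\<exists>f\<in>polyfun UNIV. vanishes_on f ((\<lambda>x. A *v x + b) ` W) \<and> (\<exists>y. f y \<noteq> 0)"
proof -
  obtain j where "\<nu> $ j \<noteq> 0"
    using assms(1) by (auto simp: vec_eq_iff)
  moreover have "(\<lambda>y. dot \<nu> (y - b)) \<in> polyfun UNIV"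
    unfolding dot_def vector_minus_component
    by (intro subalg_sum subalg.mult subalg_diff subalg.const nth_polyfun UNIV_I)
  ultimately show ?thesis
    using assms(2) by (intro bexI[of _ "\<lambda>y. dot \<nu> (y - b)"]) (auto intro!: exI[of _ "b + axis j 1"])
qed

lemma rank_failures_subset_subspace:
  fixes \<phi> :: "nat \<Rightarrow> 'a::alg_closed_field ^ 'n \<Rightarrow> 'a ^ 'm"
  assumes linear: "\<And>i. i \<in> {1..l} \<Longrightarrow> linear_polynomial_map (\<phi> i)"
    and dim: "ereal (real k) \<le> zariski_dim V"
  obtains W where "vec.subspace W" "k \<le> vec.dim W" "rank_failures l \<phi> V \<subseteq> rank_failures l \<phi> W"
proof -
  obtain C where chain: "irreducible_chain k C" and subset: "\<And>i. i \<le> k \<Longrightarrow> C i \<subseteq> V"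
    by (rule le_zariski_dim_imp_chain[OF dim]) (rule that)
  obtain A b where affine: "\<And>i. i \<in> {1..l} \<Longrightarrow> \<phi> i = (\<lambda>x. A i *v x + b i)"
    using linear_polynomial_map_affine[OF linear] by metis
  define I where "I = rank_failures l \<phi> (C k)"
  have I: "finite I" "I \<subseteq> {1..l}"
    by (auto simp: I_def rank_failures_def)
  have "\<exists>f\<in>polyfun UNIV. vanishes_on f ((\<lambda>x. A i *v x + b i) ` C k) \<and> (\<exists>y. f y \<noteq> 0)"
    if "i \<in> I" for i
    using that affine[OF subsetD[OF I(2) that]] unfolding I_def rank_failures_iff by simp
  then have "\<exists>a\<in>C k. \<forall>i\<in>I. \<exists>\<nu>. \<nu> \<noteq> 0 \<and> (\<forall>w\<in>tangent_space (C k) a. dot \<nu> (A i *v w) = 0)"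
    by (rule common_tangent_images_in_hyperplanes[OF irreducible_chain_integral_on[OF chain] I(1)])
  then obtain a where a: "a \<in> C k" and hyperplane:
    "\<forall>i\<in>I. \<exists>\<nu>. \<nu> \<noteq> 0 \<and> (\<forall>w\<in>tangent_space (C k) a. dot \<nu> (A i *v w) = 0)"
    by (elim bexE)
  define W where "W = tangent_space (C k) a"
  have "i \<in> rank_failures l \<phi> W" if i: "i \<in> I" for i
  proof -
    obtain \<nu> where "\<nu> \<noteq> 0" "\<forall>w\<in>W. dot \<nu> (A i *v w) = 0"
      using bspec[OF hyperplane i] unfolding W_def by (elim exE conjE)
    from image_in_hyperplane_not_dense[OF this, of "b i"] show ?thesis
      using subsetD[OF I(2) i] by (simp add: rank_failures_iff affine)
  qed
  then have "rank_failures l \<phi> V \<subseteq> rank_failures l \<phi> W"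
    using rank_failures_antimono[OF subset[OF order_refl], of l \<phi>] unfolding I_def by blast
  moreover have "vec.subspace W" "k \<le> vec.dim W"
    unfolding W_def using irreducible_chain_le_dim_tangent_space[OF chain a]
    by (simp_all add: tangent_space_def subspace_annihilator)
  ultimately show ?thesis
    using that[of W] by blast
qed

theorem theorem5p3:
  fixes \<phi> :: "nat \<Rightarrow> 'a::alg_closed_field ^ 'n \<Rightarrow> 'a ^ 'm"
    and k l :: nat and \<epsilon> :: real
  assumes "linear_seeded_rank_extractor_subspaces k \<epsilon> l \<phi>"
  shows "linear_seeded_rank_extractor_varieties k \<epsilon> l \<phi>"
proof -
  note extractor = assms[unfolded linear_seeded_rank_extractor_subspaces_def
      seeded_rank_extractor_subspaces_def]
  have "real (card (rank_failures l \<phi> V)) \<le> \<epsilon> * real l"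
    if dim: "ereal (real k) \<le> zariski_dim V" for V
  proof -
    obtain W where W: "vec.subspace W" "k \<le> vec.dim W" "rank_failures l \<phi> V \<subseteq> rank_failures l \<phi> W"
      by (rule rank_failures_subset_subspace[OF _ dim, of l \<phi>]) (use extractor in blast, rule that)
    have "card (rank_failures l \<phi> V) \<le> card (rank_failures l \<phi> W)"
      by (rule card_mono[OF _ W(3)]) (simp add: rank_failures_def)
    also have "real \<dots> \<le> \<epsilon> * real l"
      using extractor W(1,2) by blast
    finally show ?thesis
      by simp
  qed
  then show ?thesis
    using extractor
    by (simp add: linear_seeded_rank_extractor_varieties_def seeded_rank_extractor_varieties_def)
qed

end
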